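(* Let $G$ be a finite group, $A$ a commutative unital ring, and let $u_1,\dots,u_n$ be a choice of exactly one representative from each conjugacy class of $G$. For $i\in\{1,\dots,n\}$ and $\varphi\in\mathrm{Hom}_{Ab}(Z(u_i),A)$ let $D(\varphi)$ be the derivation of $A[G]$ given by $D(\varphi)(v)=\sum_{u\in G}(D(\varphi))_v^u\,u$ for $v\in G$, where $$(D(\varphi))_v^u=\begin{cases}\varphi(gvg^{-1}) & \text{if } v^{-1}u=uv^{-1}=g^{-1}u_ig \text{ for some } g\in G,\\ 0 & \text{else.}\end{cases}$$ Then the map $$F_{u_1,\dots,u_n}(\varphi)=D(\varphi)+\mathrm{Inn}(A[G]),$$ extended by linearity from the summands $\mathrm{Hom}_{Ab}(Z(u_i),A)$, is an isomorphism of $A$-modules $$F_{u_1,\dots,u_n}:\bigoplus_{i=1}^n\mathrm{Hom}_{Ab}(Z(u_i),A)\xrightarrow{\ \sim\ }\mathrm{Out}(A[G]).$$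
   Context: $A[G]$ is the group ring. $\mathrm{Der}(A[G])$ is the $A$-module of derivations of $A[G]$: $A$-linear maps $d:A[G]\to A[G]$ with $d(xy)=d(x)y+x\,d(y)$ for all $x,y$. For $a\in A[G]$, $\mathrm{ad}_a(x)=ax-xa$; $\mathrm{Inn}(A[G])$ consists of the finite sums $\sum_{a\in G}C_a\,\mathrm{ad}_a$, $C_a\in A$; $\mathrm{Out}(A[G])=\mathrm{Der}(A[G])/\mathrm{Inn}(A[G])$. $Z(u)$ is the centralizer of $u$ in $G$. For a group $H$, $\mathrm{Hom}_{Ab}(H,A)$ is the $A$-module (pointwise operations) of group homomorphisms from $H$ to the additive group of $A$.
   Formalization: As written D(φ) is not a derivation for noncentral u_i, φ≠0 (e.g. S_3 over F_2). D(φ) is instead any derivation (shown to exist) with the stated entries, except that those where v^{-1}u, uv^{-1} are distinct conjugates of u_i are left free, not 0; F is an isomorphism for every choice. *)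

theory Defs
  imports "HOL-Algebra.Module" "HOL-Algebra.AbelCoset"
begin

text \<open>
  The record type of modules extends that of rings. In the modules below that are not rings,
  the multiplicative fields, which the locale \<^locale>\<open>module\<close> does not inspect, are left undefined.
\<close>

definition module_iso ::
    "('a, 'k) ring_scheme \<Rightarrow> ('a, 'm) module \<Rightarrow> ('a, 'n) module \<Rightarrow> ('m \<Rightarrow> 'n) set" where
  "module_iso A M N =
    {h. module A M \<and> module A N \<and> h \<in> iso (add_monoid M) (add_monoid N) \<and>
        (\<forall>c\<in>carrier A. \<forall>x\<in>carrier M. h (c \<odot>\<^bsub>M\<^esub> x) = c \<odot>\<^bsub>N\<^esub> h x)}"

definition direct_sum_module :: "'i set \<Rightarrow> ('i \<Rightarrow> ('a, 'm) module) \<Rightarrow> ('a, 'i \<Rightarrow> 'm) module" where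
  "direct_sum_module I M =
    \<lparr>carrier = {x \<in> \<Pi>\<^sub>E i\<in>I. carrier (M i). finite {i \<in> I. x i \<noteq> \<zero>\<^bsub>M i\<^esub>}},
     mult = undefined, one = undefined,
     zero = (\<lambda>i\<in>I. \<zero>\<^bsub>M i\<^esub>),
     add = (\<lambda>x y. \<lambda>i\<in>I. x i \<oplus>\<^bsub>M i\<^esub> y i),
     smult = (\<lambda>c x. \<lambda>i\<in>I. c \<odot>\<^bsub>M i\<^esub> x i)\<rparr>"

definition quotient_module :: "('a, 'm) module \<Rightarrow> 'm set \<Rightarrow> ('a, 'm set) module" where
  "quotient_module M N =
    \<lparr>carrier = a_rcosets\<^bsub>M\<^esub> N,
     mult = undefined, one = undefined,
     zero = N,
     add = set_add M,
     smult = (\<lambda>c X. \<Union>x\<in>X. N +>\<^bsub>M\<^esub> (c \<odot>\<^bsub>M\<^esub> x))\<rparr>"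

definition centralizer :: "('g, 'h) monoid_scheme \<Rightarrow> 'g \<Rightarrow> 'g set" where
  "centralizer G w = {g \<in> carrier G. g \<otimes>\<^bsub>G\<^esub> w = w \<otimes>\<^bsub>G\<^esub> g}"

definition conjugate :: "('g, 'h) monoid_scheme \<Rightarrow> 'g \<Rightarrow> 'g \<Rightarrow> bool" where
  "conjugate G w x \<longleftrightarrow> (\<exists>g\<in>carrier G. x = inv\<^bsub>G\<^esub> g \<otimes>\<^bsub>G\<^esub> w \<otimes>\<^bsub>G\<^esub> g)"

definition conj_class_reps :: "('g, 'h) monoid_scheme \<Rightarrow> nat \<Rightarrow> (nat \<Rightarrow> 'g) \<Rightarrow> bool" where
  "conj_class_reps G n u \<longleftrightarrow>
    (\<forall>i\<in>{1..n}. u i \<in> carrier G) \<and>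
    (\<forall>x\<in>carrier G. \<exists>!i. i \<in> {1..n} \<and> conjugate G (u i) x)"

definition Hom_Ab ::
    "('g, 'h) monoid_scheme \<Rightarrow> ('a, 'k) ring_scheme \<Rightarrow> 'g set \<Rightarrow> ('a, 'g \<Rightarrow> 'a) module" where
  "Hom_Ab G A H =
    \<lparr>carrier = hom (G\<lparr>carrier := H\<rparr>) (add_monoid A) \<inter> extensional H,
     mult = undefined, one = undefined,
     zero = (\<lambda>x\<in>H. \<zero>\<^bsub>A\<^esub>),
     add = (\<lambda>\<phi> \<psi>. \<lambda>x\<in>H. \<phi> x \<oplus>\<^bsub>A\<^esub> \<psi> x),
     smult = (\<lambda>c \<phi>. \<lambda>x\<in>H. c \<otimes>\<^bsub>A\<^esub> \<phi> x)\<rparr>"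

definition gr_basis :: "('a, 'k) ring_scheme \<Rightarrow> ('g, 'h) monoid_scheme \<Rightarrow> 'g \<Rightarrow> 'g \<Rightarrow> 'a" where
  "gr_basis A G v = (\<lambda>g\<in>carrier G. if g = v then \<one>\<^bsub>A\<^esub> else \<zero>\<^bsub>A\<^esub>)"

text \<open>
  The group ring of a \<^emph>\<open>finite\<close> group, for which no support condition is needed: an element is
  its coefficient function.
\<close>

definition group_ring ::
    "('a, 'k) ring_scheme \<Rightarrow> ('g, 'h) monoid_scheme \<Rightarrow> ('a, 'g \<Rightarrow> 'a) module" where
  "group_ring A G =
    \<lparr>carrier = carrier G \<rightarrow>\<^sub>E carrier A,
     mult = (\<lambda>x y. \<lambda>g\<in>carrier G. \<Oplus>\<^bsub>A\<^esub>h\<in>carrier G. x h \<otimes>\<^bsub>A\<^esub> y (inv\<^bsub>G\<^esub> h \<otimes>\<^bsub>G\<^esub> g)),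
     one = gr_basis A G \<one>\<^bsub>G\<^esub>,
     zero = (\<lambda>g\<in>carrier G. \<zero>\<^bsub>A\<^esub>),
     add = (\<lambda>x y. \<lambda>g\<in>carrier G. x g \<oplus>\<^bsub>A\<^esub> y g),
     smult = (\<lambda>c x. \<lambda>g\<in>carrier G. c \<otimes>\<^bsub>A\<^esub> x g)\<rparr>"

definition derivations ::
    "('a, 'k) ring_scheme \<Rightarrow> ('a, 'r) module \<Rightarrow> ('r \<Rightarrow> 'r) set" where
  "derivations A R =
    {d \<in> carrier R \<rightarrow>\<^sub>E carrier R.
      (\<forall>x\<in>carrier R. \<forall>y\<in>carrier R. d (x \<oplus>\<^bsub>R\<^esub> y) = d x \<oplus>\<^bsub>R\<^esub> d y) \<and>
      (\<forall>c\<in>carrier A. \<forall>x\<in>carrier R. d (c \<odot>\<^bsub>R\<^esub> x) = c \<odot>\<^bsub>R\<^esub> d x) \<and>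
      (\<forall>x\<in>carrier R. \<forall>y\<in>carrier R. d (x \<otimes>\<^bsub>R\<^esub> y) = d x \<otimes>\<^bsub>R\<^esub> y \<oplus>\<^bsub>R\<^esub> x \<otimes>\<^bsub>R\<^esub> d y)}"

definition Der ::
    "('a, 'k) ring_scheme \<Rightarrow> ('g, 'h) monoid_scheme \<Rightarrow> ('a, ('g \<Rightarrow> 'a) \<Rightarrow> 'g \<Rightarrow> 'a) module" where
  "Der A G =
    (let R = group_ring A G in
    \<lparr>carrier = derivations A R,
     mult = undefined, one = undefined,
     zero = (\<lambda>x\<in>carrier R. \<zero>\<^bsub>R\<^esub>),
     add = (\<lambda>d e. \<lambda>x\<in>carrier R. d x \<oplus>\<^bsub>R\<^esub> e x),
     smult = (\<lambda>c d. \<lambda>x\<in>carrier R. c \<odot>\<^bsub>R\<^esub> d x)\<rparr>)"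

definition ad ::
    "('a, 'k) ring_scheme \<Rightarrow> ('g, 'h) monoid_scheme \<Rightarrow> ('g \<Rightarrow> 'a) \<Rightarrow> ('g \<Rightarrow> 'a) \<Rightarrow> 'g \<Rightarrow> 'a" where
  "ad A G a =
    (let R = group_ring A G in (\<lambda>x\<in>carrier R. (a \<otimes>\<^bsub>R\<^esub> x) \<ominus>\<^bsub>R\<^esub> (x \<otimes>\<^bsub>R\<^esub> a)))"

definition Inn ::
    "('a, 'k) ring_scheme \<Rightarrow> ('g, 'h) monoid_scheme \<Rightarrow> (('g \<Rightarrow> 'a) \<Rightarrow> 'g \<Rightarrow> 'a) set" where
  "Inn A G =
    {(\<Oplus>\<^bsub>Der A G\<^esub>a\<in>carrier G. C a \<odot>\<^bsub>Der A G\<^esub> ad A G (gr_basis A G a)) | C.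
      C \<in> carrier G \<rightarrow> carrier A}"

definition Out ::
    "('a, 'k) ring_scheme \<Rightarrow> ('g, 'h) monoid_scheme \<Rightarrow> ('a, (('g \<Rightarrow> 'a) \<Rightarrow> 'g \<Rightarrow> 'a) set) module" where
  "Out A G = quotient_module (Der A G) (Inn A G)"

text \<open>
  \<open>D_spec A G w \<phi> d\<close> says that the derivation \<open>d\<close> may serve as \<open>D(\<phi>)\<close>, where \<open>\<phi>\<close> is a homomorphism
  from the centralizer of \<open>w\<close> to the additive group of \<open>A\<close>. The coefficient of \<open>u\<close> in \<open>d(v)\<close> is
  \<open>\<phi> (g v g\<^sup>-\<^sup>1)\<close> if \<open>v\<^sup>-\<^sup>1 u = u v\<^sup>-\<^sup>1 = g\<^sup>-\<^sup>1 w g\<close>, for every such \<open>g\<close>, and it is zero if \<open>v\<^sup>-\<^sup>1 u\<close>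
  (equivalently \<open>u v\<^sup>-\<^sup>1\<close>) is not conjugate to \<open>w\<close>.

  No value is prescribed if \<open>v\<^sup>-\<^sup>1 u\<close> and \<open>u v\<^sup>-\<^sup>1\<close> are distinct conjugates of \<open>w\<close>. Prescribing zero there
  as well would in general not give a derivation: if \<open>w\<close> is not central, choose \<open>x\<close> not commuting
  with \<open>w\<close>; for \<open>z\<close> centralizing \<open>w\<close>, comparing the coefficients of \<open>z w\<close> in
  \<open>d(z) = d(z x\<^sup>-\<^sup>1) x + z x\<^sup>-\<^sup>1 d(x)\<close> would give \<open>\<phi>(z) = 0\<close>.
\<close>

definition D_spec ::
    "('a, 'k) ring_scheme \<Rightarrow> ('g, 'h) monoid_scheme \<Rightarrow> 'g \<Rightarrow> ('g \<Rightarrow> 'a) \<Rightarrow>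
      (('g \<Rightarrow> 'a) \<Rightarrow> 'g \<Rightarrow> 'a) \<Rightarrow> bool" where
  "D_spec A G w \<phi> d \<longleftrightarrow>
    d \<in> carrier (Der A G) \<and>
    (\<forall>u\<in>carrier G. \<forall>v\<in>carrier G.
      (\<forall>g\<in>carrier G.
        inv\<^bsub>G\<^esub> v \<otimes>\<^bsub>G\<^esub> u = u \<otimes>\<^bsub>G\<^esub> inv\<^bsub>G\<^esub> v \<and>
        u \<otimes>\<^bsub>G\<^esub> inv\<^bsub>G\<^esub> v = inv\<^bsub>G\<^esub> g \<otimes>\<^bsub>G\<^esub> w \<otimes>\<^bsub>G\<^esub> g \<longrightarrow>
        d (gr_basis A G v) u = \<phi> (g \<otimes>\<^bsub>G\<^esub> v \<otimes>\<^bsub>G\<^esub> inv\<^bsub>G\<^esub> g)) \<and>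
      (\<not> conjugate G w (inv\<^bsub>G\<^esub> v \<otimes>\<^bsub>G\<^esub> u) \<longrightarrow> d (gr_basis A G v) u = \<zero>\<^bsub>A\<^esub>))"

definition F_map ::
    "('a, 'k) ring_scheme \<Rightarrow> ('g, 'h) monoid_scheme \<Rightarrow> nat \<Rightarrow>
      (nat \<Rightarrow> ('g \<Rightarrow> 'a) \<Rightarrow> ('g \<Rightarrow> 'a) \<Rightarrow> 'g \<Rightarrow> 'a) \<Rightarrow>
      (nat \<Rightarrow> 'g \<Rightarrow> 'a) \<Rightarrow> (('g \<Rightarrow> 'a) \<Rightarrow> 'g \<Rightarrow> 'a) set" where
  "F_map A G n D \<phi> = (\<Oplus>\<^bsub>Out A G\<^esub>i\<in>{1..n}. Inn A G +>\<^bsub>Der A G\<^esub> D i (\<phi> i))"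

end

theory Submission
  imports Defs
begin

text \<open>
  Write \<open>c(v,u)\<close> for the coefficient of \<open>u\<close> in \<open>d(v)\<close>. A linear map \<open>d\<close> is a derivation iff
  \<open>c(hk,u) = c(h,uk\<^sup>-\<^sup>1) + c(k,h\<^sup>-\<^sup>1u)\<close>, that is, iff \<open>c\<close> is an additive character of the action groupoid
  of \<open>G\<close> on itself by conjugation, where \<open>(v,u)\<close> is an arrow between the objects \<open>uv\<^sup>-\<^sup>1\<close> and
  \<open>v\<^sup>-\<^sup>1u\<close>. Restricting \<open>c\<close> to the loops at \<open>w\<close> gives a homomorphism \<open>z \<mapsto> c(z,wz)\<close> on the
  centralizer of \<open>w\<close>. If these vanish for one \<open>w\<close> in each conjugacy class, then \<open>c\<close> has the potential
  \<open>a(g\<^sup>-\<^sup>1wg) = -c(g,wg)\<close>, and so \<open>d\<close> is inner. Since \<open>D(\<phi>)\<close> restricts to \<open>\<phi>\<close> on its own centralizer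
  and to zero on the others, \<open>F\<close> is the inverse of the map induced on \<open>Out\<close> by all the restrictions.
\<close>

section \<open>Modules\<close>

text \<open>The condition on \<open>D(\<phi>)\<close> fixes coefficients only at loops and outside
  the class of \<open>w\<close>; at an arrow between distinct conjugates of \<open>w\<close> the
  value is free. So \<open>D(\<phi>)\<close> is determined only modulo inner derivations, and
  independent choices for different \<open>\<phi>\<close> need not depend linearly on
  \<open>\<phi>\<close>. Linearity can appear only in the quotient, and it is tested there by the
  restrictions, which are linear on all derivations and have exactly \<open>Inn\<close> as common
  kernel.

  That some \<open>D(\<phi>)\<close> exists is a separate matter. A conjugator \<open>t x\<close> is
  chosen for each conjugate \<open>x\<close> of \<open>w\<close>. An arrow \<open>v\<close> from
  \<open>x\<close> to \<open>y\<close> is then carried to the loop \<open>t x * v * (t y)^-1\<close>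
  at \<open>w\<close>, and \<open>\<phi>\<close> is applied to that loop. At a loop of the groupoid,
  another choice of \<open>t\<close> changes the argument of \<open>\<phi>\<close> by a conjugation
  inside the centralizer, which \<open>\<phi>\<close> cannot see because its values lie in an
  abelian group. At the other arrows the result does depend on \<open>t\<close>, which is the
  freedom left open by \<open>D_spec\<close>.\<close>

definition regular_module :: "('a, 'k) ring_scheme \<Rightarrow> ('a, 'a) module" where
  "regular_module A =
    \<lparr>carrier = carrier A, mult = undefined, one = undefined, zero = \<zero>\<^bsub>A\<^esub>,
     add = (\<lambda>x y. x \<oplus>\<^bsub>A\<^esub> y), smult = (\<lambda>c x. c \<otimes>\<^bsub>A\<^esub> x)\<rparr>"

text \<open>Negation and finite sums are defined from the carrier, the addition and the zero alone,
  and these fields agree with those of \<open>A\<close>. A coefficient of a sum of functions may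
  therefore be computed in \<open>A\<close> itself.\<close>

lemma regular_module_simps [simp]:
  "carrier (regular_module A) = carrier A"
  "\<zero>\<^bsub>regular_module A\<^esub> = \<zero>\<^bsub>A\<^esub>"
  "x \<oplus>\<^bsub>regular_module A\<^esub> y = x \<oplus>\<^bsub>A\<^esub> y"
  "c \<odot>\<^bsub>regular_module A\<^esub> x = c \<otimes>\<^bsub>A\<^esub> x"
  "\<ominus>\<^bsub>regular_module A\<^esub> x = \<ominus>\<^bsub>A\<^esub> x"
  "finsum (regular_module A) f F = finsum A f F"
  by (simp_all add: regular_module_def a_inv_def m_inv_def finsum_def finprod_def)

lemma module_regular_module:
  assumes "cring A"
  shows "module A (regular_module A)"
proof -
  interpret cring A by fact
  show ?thesis
  proof (rule moduleI)
    show "abelian_group (regular_module A)"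
    proof (rule abelian_groupI)
      show "\<exists>y\<in>carrier (regular_module A). y \<oplus>\<^bsub>regular_module A\<^esub> x = \<zero>\<^bsub>regular_module A\<^esub>"
        if "x \<in> carrier (regular_module A)" for x
        using that by (auto intro!: bexI[of _ "\<ominus>\<^bsub>A\<^esub> x"] simp: l_neg)
    qed (auto simp: a_ac)
  qed (auto simp: assms l_distr r_distr m_assoc)
qed

section \<open>Modules of functions with pointwise operations\<close>

text \<open>Common source of the module axioms for direct sums, the group ring, derivations (as
  functions on the group ring) and homomorphisms into \<open>A\<close>: each of them then only owes
  the closure of its carrier. The components \<open>N i\<close> may vary with \<open>i\<close> for
  the sake of direct sums.\<close>

locale pointwise_module = A?: cring A
  for A (structure) and I :: "'i set" and N :: "'i \<Rightarrow> ('a, 'm) module"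
    and M :: "('a, 'i \<Rightarrow> 'm) module" +
  assumes component: "\<And>i. i \<in> I \<Longrightarrow> module A (N i)"
    and carrier_subset: "carrier M \<subseteq> (\<Pi>\<^sub>E i\<in>I. carrier (N i))"
    and zero_mem: "\<zero>\<^bsub>M\<^esub> \<in> carrier M"
    and add_mem: "\<And>x y. x \<in> carrier M \<Longrightarrow> y \<in> carrier M \<Longrightarrow> x \<oplus>\<^bsub>M\<^esub> y \<in> carrier M"
    and smult_mem: "\<And>c x. c \<in> carrier A \<Longrightarrow> x \<in> carrier M \<Longrightarrow> c \<odot>\<^bsub>M\<^esub> x \<in> carrier M"
    and zero_eq: "\<zero>\<^bsub>M\<^esub> = (\<lambda>i\<in>I. \<zero>\<^bsub>N i\<^esub>)"
    and add_eq: "\<And>x y. x \<oplus>\<^bsub>M\<^esub> y = (\<lambda>i\<in>I. x i \<oplus>\<^bsub>N i\<^esub> y i)"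
    and smult_eq: "\<And>c x. c \<odot>\<^bsub>M\<^esub> x = (\<lambda>i\<in>I. c \<odot>\<^bsub>N i\<^esub> x i)"
begin

lemma apply_mem: "x \<in> carrier M \<Longrightarrow> i \<in> I \<Longrightarrow> x i \<in> carrier (N i)"
  using carrier_subset by auto

lemma eqI:
  assumes "x \<in> carrier M" "y \<in> carrier M" "\<And>i. i \<in> I \<Longrightarrow> x i = y i"
  shows "x = y"
  using assms carrier_subset by (intro PiE_ext[of x I _ y]) auto

lemma component_abelian_group: "i \<in> I \<Longrightarrow> abelian_group (N i)"
  using component by (simp add: module_def)

lemma is_module: "module A M"
proof (rule moduleI)
  show "abelian_group M"
  proof (rule abelian_groupI)
    fix x y z assume x: "x \<in> carrier M" and y: "y \<in> carrier M" and z: "z \<in> carrier M"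
    show "x \<oplus>\<^bsub>M\<^esub> y \<oplus>\<^bsub>M\<^esub> z = x \<oplus>\<^bsub>M\<^esub> (y \<oplus>\<^bsub>M\<^esub> z)"
      using x y z component_abelian_group
      by (intro eqI add_mem) (auto simp: add_eq apply_mem abelian_monoid.a_assoc abelian_group.axioms(1))
    show "x \<oplus>\<^bsub>M\<^esub> y = y \<oplus>\<^bsub>M\<^esub> x"
      using x y component_abelian_group
      by (intro eqI add_mem) (auto simp: add_eq apply_mem abelian_monoid.a_comm abelian_group.axioms(1))
  next
    fix x assume x: "x \<in> carrier M"
    show "\<zero>\<^bsub>M\<^esub> \<oplus>\<^bsub>M\<^esub> x = x"
      using x component_abelian_group
      by (intro eqI add_mem zero_mem)
        (auto simp: add_eq zero_eq apply_mem abelian_monoid.l_zero abelian_group.axioms(1))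
    \<comment> \<open>The additive inverse is produced as the multiple by -1, so closure under
      negation follows from \<open>smult_mem\<close>.\<close>
    have "(\<ominus>\<^bsub>A\<^esub> \<one>\<^bsub>A\<^esub>) \<odot>\<^bsub>M\<^esub> x \<oplus>\<^bsub>M\<^esub> x = \<zero>\<^bsub>M\<^esub>"
    proof (intro eqI add_mem smult_mem zero_mem x)
      fix i assume i: "i \<in> I"
      interpret Ni: module A "N i" using component i .
      show "((\<ominus>\<^bsub>A\<^esub> \<one>\<^bsub>A\<^esub>) \<odot>\<^bsub>M\<^esub> x \<oplus>\<^bsub>M\<^esub> x) i = \<zero>\<^bsub>M\<^esub> i"
        using i x by (simp add: add_eq zero_eq smult_eq apply_mem Ni.smult_l_minus Ni.l_neg)
    qed simp
    then show "\<exists>y\<in>carrier M. y \<oplus>\<^bsub>M\<^esub> x = \<zero>\<^bsub>M\<^esub>"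
      using x by (meson A.a_inv_closed A.one_closed smult_mem)
  qed (auto simp: zero_mem add_mem)
next
  show "cring A" ..
  fix a b x y
  assume a: "a \<in> carrier A" and b: "b \<in> carrier A" and x: "x \<in> carrier M" and y: "y \<in> carrier M"
  show "(a \<oplus>\<^bsub>A\<^esub> b) \<odot>\<^bsub>M\<^esub> x = a \<odot>\<^bsub>M\<^esub> x \<oplus>\<^bsub>M\<^esub> b \<odot>\<^bsub>M\<^esub> x"
    using a b x by (intro eqI add_mem smult_mem)
      (auto simp: add_eq smult_eq apply_mem module.smult_l_distr[OF component])
  show "a \<odot>\<^bsub>M\<^esub> (x \<oplus>\<^bsub>M\<^esub> y) = a \<odot>\<^bsub>M\<^esub> x \<oplus>\<^bsub>M\<^esub> a \<odot>\<^bsub>M\<^esub> y"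
    using a x y by (intro eqI add_mem smult_mem)
      (auto simp: add_eq smult_eq apply_mem module.smult_r_distr[OF component])
  show "(a \<otimes>\<^bsub>A\<^esub> b) \<odot>\<^bsub>M\<^esub> x = a \<odot>\<^bsub>M\<^esub> (b \<odot>\<^bsub>M\<^esub> x)"
    using a b x by (intro eqI add_mem smult_mem)
      (auto simp: add_eq smult_eq apply_mem module.smult_assoc1[OF component])
next
  fix x assume x: "x \<in> carrier M"
  show "\<one>\<^bsub>A\<^esub> \<odot>\<^bsub>M\<^esub> x = x"
    using x by (intro eqI smult_mem) (auto simp: smult_eq apply_mem module.smult_one[OF component])
qed (auto simp: smult_mem)

end

section \<open>Linear maps and quotient modules\<close>

text \<open>Values outside the carrier are left free, so that evaluation at a point, the coset map
  and coefficient functionals qualify as they stand.\<close>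

definition module_hom ::
    "('a, 'k) ring_scheme \<Rightarrow> ('a, 'm) module \<Rightarrow> ('a, 'n) module \<Rightarrow> ('m \<Rightarrow> 'n) set" where
  "module_hom A M N =
    {h \<in> carrier M \<rightarrow> carrier N.
      (\<forall>x\<in>carrier M. \<forall>y\<in>carrier M. h (x \<oplus>\<^bsub>M\<^esub> y) = h x \<oplus>\<^bsub>N\<^esub> h y) \<and>
      (\<forall>c\<in>carrier A. \<forall>x\<in>carrier M. h (c \<odot>\<^bsub>M\<^esub> x) = c \<odot>\<^bsub>N\<^esub> h x)}"

lemma
  assumes "h \<in> module_hom A M N"
  shows module_hom_closed: "x \<in> carrier M \<Longrightarrow> h x \<in> carrier N"
    and module_hom_add: "x \<in> carrier M \<Longrightarrow> y \<in> carrier M \<Longrightarrow> h (x \<oplus>\<^bsub>M\<^esub> y) = h x \<oplus>\<^bsub>N\<^esub> h y"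
    and module_hom_smult:
      "c \<in> carrier A \<Longrightarrow> x \<in> carrier M \<Longrightarrow> h (c \<odot>\<^bsub>M\<^esub> x) = c \<odot>\<^bsub>N\<^esub> h x"
  using assms by (auto simp: module_hom_def)

lemma
  assumes h: "h \<in> module_hom A M N" and M: "module A M" and N: "module A N"
  shows module_hom_zero: "h \<zero>\<^bsub>M\<^esub> = \<zero>\<^bsub>N\<^esub>"
    and module_hom_minus: "x \<in> carrier M \<Longrightarrow> h (\<ominus>\<^bsub>M\<^esub> x) = \<ominus>\<^bsub>N\<^esub> h x"
    and module_hom_finsum:
      "f \<in> F \<rightarrow> carrier M \<Longrightarrow> h (finsum M f F) = (\<Oplus>\<^bsub>N\<^esub>k\<in>F. h (f k))"
proof -
  interpret M: module A M by (rule M)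
  interpret N: module A N by (rule N)
  note [simp] = module_hom_closed[OF h] module_hom_add[OF h]
  have "h \<zero>\<^bsub>M\<^esub> = h (\<zero>\<^bsub>A\<^esub> \<odot>\<^bsub>M\<^esub> \<zero>\<^bsub>M\<^esub>)" by simp
  also have "\<dots> = \<zero>\<^bsub>N\<^esub>" by (subst module_hom_smult[OF h]) simp_all
  finally show zero: "h \<zero>\<^bsub>M\<^esub> = \<zero>\<^bsub>N\<^esub>" .
  show "h (\<ominus>\<^bsub>M\<^esub> x) = \<ominus>\<^bsub>N\<^esub> h x" if x: "x \<in> carrier M"
    using x zero by (metis M.a_inv_closed M.l_neg N.minus_equality module_hom_add[OF h] module_hom_closed[OF h])
  show "h (finsum M f F) = (\<Oplus>\<^bsub>N\<^esub>k\<in>F. h (f k))" if "f \<in> F \<rightarrow> carrier M"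
    using that
  proof (induction F rule: infinite_finite_induct)
    case (insert k F)
    then have "f \<in> F \<rightarrow> carrier M" "f k \<in> carrier M" by auto
    then show ?case
      using insert by (simp add: M.finsum_insert N.finsum_insert Pi_def)
  qed (simp_all add: zero)
qed

text \<open>Combined with \<open>module_hom_finsum\<close>, this evaluates a finite sum of functions
  pointwise.\<close>

lemma (in pointwise_module) apply_module_hom:
  "i \<in> I \<Longrightarrow> (\<lambda>x. x i) \<in> module_hom A M (N i)"
  by (auto simp: module_hom_def apply_mem add_eq smult_eq)

lemma quotient_module_simps [simp]:
  "carrier (quotient_module M N) = a_rcosets\<^bsub>M\<^esub> N"
  "\<zero>\<^bsub>quotient_module M N\<^esub> = N"
  "X \<oplus>\<^bsub>quotient_module M N\<^esub> Y = X <+>\<^bsub>M\<^esub> Y"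
  "c \<odot>\<^bsub>quotient_module M N\<^esub> X = (\<Union>x\<in>X. N +>\<^bsub>M\<^esub> (c \<odot>\<^bsub>M\<^esub> x))"
  by (simp_all add: quotient_module_def)

lemma (in module) a_coset_eq_iff:
  assumes N: "submodule N R M" and "x \<in> carrier M" "y \<in> carrier M"
  shows "N +>\<^bsub>M\<^esub> x = N +>\<^bsub>M\<^esub> y \<longleftrightarrow> x \<ominus>\<^bsub>M\<^esub> y \<in> N"
proof -
  have sub: "subgroup N (add_monoid M)" using N by (rule submodule.axioms)
  then have sub': "N \<subseteq> carrier M" using submoduleE(1)[OF N] by simp
  show ?thesis
  proof
    assume "N +>\<^bsub>M\<^esub> x = N +>\<^bsub>M\<^esub> y"
    then have "N +>\<^bsub>M\<^esub> (x \<oplus>\<^bsub>M\<^esub> \<ominus>\<^bsub>M\<^esub> y) = N"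
      using assms sub' by (intro M.a_coset_add_inv2)
    then show "x \<ominus>\<^bsub>M\<^esub> y \<in> N"
      using M.a_coset_join1[OF _ _ sub] assms by (simp add: M.minus_eq)
  next
    assume "x \<ominus>\<^bsub>M\<^esub> y \<in> N"
    then have "N +>\<^bsub>M\<^esub> (x \<oplus>\<^bsub>M\<^esub> \<ominus>\<^bsub>M\<^esub> y) = N"
      using M.a_coset_join2[OF _ sub] assms by (simp add: M.minus_eq)
    then show "N +>\<^bsub>M\<^esub> x = N +>\<^bsub>M\<^esub> y"
      using assms sub' by (intro M.a_coset_add_inv1)
  qed
qed

lemma
  fixes M :: "('a, 'm) module"
  assumes M: "module R M" and N: "submodule N R M"
  shows module_quotient_module: "module R (quotient_module M N)"
    and coset_module_hom: "(\<lambda>x. N +>\<^bsub>M\<^esub> x) \<in> module_hom R M (quotient_module M N)"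
proof -
  interpret module R M by (rule M)
  have sub: "subgroup N (add_monoid M)" using N by (rule submodule.axioms)
  then have sub': "N \<subseteq> carrier M" using submoduleE(1)[OF N] by simp
  interpret N: abelian_subgroup N M
    by (intro abelian_subgroupI3 additive_subgroupI sub M.abelian_group_axioms)
  \<comment> \<open>Scalar multiplication in the quotient is a union over all representatives of a
    coset. Two representatives differ by an element of \<open>N\<close>, which is stable under
    scalars, so every member of the union is the same coset; the union is not empty because a coset
    contains its representative.\<close>
  have smult: "(\<Union>y\<in>N +>\<^bsub>M\<^esub> x. N +>\<^bsub>M\<^esub> (c \<odot>\<^bsub>M\<^esub> y)) = N +>\<^bsub>M\<^esub> (c \<odot>\<^bsub>M\<^esub> x)"
    if c: "c \<in> carrier R" and x: "x \<in> carrier M" for c x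
  proof -
    have "N +>\<^bsub>M\<^esub> (c \<odot>\<^bsub>M\<^esub> y) = N +>\<^bsub>M\<^esub> (c \<odot>\<^bsub>M\<^esub> x)" if y: "y \<in> N +>\<^bsub>M\<^esub> x" for y
    proof -
      have yM: "y \<in> carrier M" using y x sub' M.a_r_coset_subset_G by blast
      have "N +>\<^bsub>M\<^esub> y = N +>\<^bsub>M\<^esub> x" using M.a_repr_independence[OF y x sub] by simp
      then have "y \<ominus>\<^bsub>M\<^esub> x \<in> N" using a_coset_eq_iff[OF N yM x] by simp
      then have "c \<odot>\<^bsub>M\<^esub> (y \<ominus>\<^bsub>M\<^esub> x) \<in> N" using c by (intro submoduleE(4)[OF N])
      then have "c \<odot>\<^bsub>M\<^esub> y \<ominus>\<^bsub>M\<^esub> c \<odot>\<^bsub>M\<^esub> x \<in> N"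
        using c x yM by (simp add: M.minus_eq smult_r_distr smult_r_minus)
      then show ?thesis using a_coset_eq_iff[OF N] c x yM by simp
    qed
    moreover have "N +>\<^bsub>M\<^esub> x \<noteq> {}" using N.a_rcos_self[OF x] by auto
    ultimately show ?thesis by simp
  qed
  have carr: "a_rcosets\<^bsub>M\<^esub> N = (\<lambda>x. N +>\<^bsub>M\<^esub> x) ` carrier M"
    by (auto simp: A_RCOSETS_def')
  show "(\<lambda>x. N +>\<^bsub>M\<^esub> x) \<in> module_hom R M (quotient_module M N)"
    by (auto simp: module_hom_def carr smult N.a_rcos_sum)
  have smult': "c \<odot>\<^bsub>quotient_module M N\<^esub> (N +>\<^bsub>M\<^esub> x) = N +>\<^bsub>M\<^esub> (c \<odot>\<^bsub>M\<^esub> x)"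
    if "c \<in> carrier R" "x \<in> carrier M" for c x
    using smult[OF that] by simp
  have zero: "N = N +>\<^bsub>M\<^esub> \<zero>\<^bsub>M\<^esub>" using sub' by simp
  show "module R (quotient_module M N)"
  proof (rule moduleI)
    show "abelian_group (quotient_module M N)"
    proof (rule abelian_groupI)
      fix X assume "X \<in> carrier (quotient_module M N)"
      then obtain x where x: "x \<in> carrier M" "X = N +>\<^bsub>M\<^esub> x" by (auto simp: carr)
      have "(N +>\<^bsub>M\<^esub> \<ominus>\<^bsub>M\<^esub> x) <+>\<^bsub>M\<^esub> X = N"
        using x zero by (simp add: N.a_rcos_sum M.l_neg)
      then show "\<exists>Y\<in>carrier (quotient_module M N).
          Y \<oplus>\<^bsub>quotient_module M N\<^esub> X = \<zero>\<^bsub>quotient_module M N\<^esub>"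
        using x by (auto simp: carr)
    next
      show "\<zero>\<^bsub>quotient_module M N\<^esub> \<in> carrier (quotient_module M N)"
        using zero by (auto simp: carr)
    qed (auto simp: carr N.a_rcos_sum M.a_ac N.rcosets_add_eq)
  qed (auto simp: carr N.a_rcos_sum smult' smult_l_distr smult_r_distr smult_assoc1 R.is_cring
      simp del: quotient_module_simps(4))
qed

section \<open>Direct sums and families of sections\<close>

lemma pointwise_module_direct_sum:
  assumes "cring A" and "\<And>i. i \<in> I \<Longrightarrow> module A (M i)"
  shows "pointwise_module A I M (direct_sum_module I M)"
proof -
  interpret cring A by fact
  show ?thesis
  proof (intro pointwise_module.intro pointwise_module_axioms.intro)
    fix x y
    assume x: "x \<in> carrier (direct_sum_module I M)" and y: "y \<in> carrier (direct_sum_module I M)"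
    have ag: "abelian_group (M i)" if "i \<in> I" for i using assms(2)[OF that] by (simp add: module_def)
    have "{i \<in> I. x i \<oplus>\<^bsub>M i\<^esub> y i \<noteq> \<zero>\<^bsub>M i\<^esub>} \<subseteq> {i \<in> I. x i \<noteq> \<zero>\<^bsub>M i\<^esub>} \<union> {i \<in> I. y i \<noteq> \<zero>\<^bsub>M i\<^esub>}"
      using ag by (auto simp: abelian_monoid.l_zero abelian_monoid.zero_closed abelian_group.axioms(1))
    then have "finite {i \<in> I. x i \<oplus>\<^bsub>M i\<^esub> y i \<noteq> \<zero>\<^bsub>M i\<^esub>}"
      by (rule finite_subset) (use x y in \<open>auto simp: direct_sum_module_def\<close>)
    then show "x \<oplus>\<^bsub>direct_sum_module I M\<^esub> y \<in> carrier (direct_sum_module I M)"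
      using x y ag by (auto simp: direct_sum_module_def PiE_iff abelian_monoid.a_closed abelian_group.axioms(1)
          cong: conj_cong)
  next
    fix c x
    assume c: "c \<in> carrier A" and x: "x \<in> carrier (direct_sum_module I M)"
    have "{i \<in> I. c \<odot>\<^bsub>M i\<^esub> x i \<noteq> \<zero>\<^bsub>M i\<^esub>} \<subseteq> {i \<in> I. x i \<noteq> \<zero>\<^bsub>M i\<^esub>}"
      using c by (auto simp: module.smult_r_null[OF assms(2)])
    then have "finite {i \<in> I. c \<odot>\<^bsub>M i\<^esub> x i \<noteq> \<zero>\<^bsub>M i\<^esub>}"
      by (rule finite_subset) (use x in \<open>auto simp: direct_sum_module_def\<close>)
    then show "c \<odot>\<^bsub>direct_sum_module I M\<^esub> x \<in> carrier (direct_sum_module I M)"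
      using x c by (auto simp: direct_sum_module_def PiE_iff module.smult_closed[OF assms(2)] cong: conj_cong)
  next
    show "\<zero>\<^bsub>direct_sum_module I M\<^esub> \<in> carrier (direct_sum_module I M)"
      using assms(2) by (auto simp: direct_sum_module_def module_def abelian_group_def
          abelian_monoid.zero_closed cong: conj_cong)
  qed (auto simp: assms direct_sum_module_def)
qed

text \<open>
  The sections \<open>S i\<close> need not be linear: additivity and homogeneity hold modulo the common
  kernel \<open>N\<close> of the \<open>R i\<close>.
\<close>

lemma module_iso_direct_sum_quotient:
  fixes M :: "('a, 'm) module" and P :: "'i \<Rightarrow> ('a, 'p) module"
  assumes M: "module A M" and P: "\<And>i. i \<in> I \<Longrightarrow> module A (P i)" and fin: "finite I"
    and R: "\<And>i. i \<in> I \<Longrightarrow> R i \<in> module_hom A M (P i)"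
    and N: "N = {m \<in> carrier M. \<forall>i\<in>I. R i m = \<zero>\<^bsub>P i\<^esub>}"
    and S: "\<And>i p. i \<in> I \<Longrightarrow> p \<in> carrier (P i) \<Longrightarrow> S i p \<in> carrier M"
    and RS: "\<And>i j p. i \<in> I \<Longrightarrow> j \<in> I \<Longrightarrow> p \<in> carrier (P i) \<Longrightarrow>
      R j (S i p) = (if j = i then p else \<zero>\<^bsub>P j\<^esub>)"
  shows "(\<lambda>\<phi>. \<Oplus>\<^bsub>quotient_module M N\<^esub>i\<in>I. N +>\<^bsub>M\<^esub> S i (\<phi> i))
    \<in> module_iso A (direct_sum_module I P) (quotient_module M N)"
proof -
  interpret M: module A M by (rule M)
  interpret DS: pointwise_module A I P "direct_sum_module I P"
    by (intro pointwise_module_direct_sum P M.is_cring)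
  let ?DS = "direct_sum_module I P" and ?Q = "quotient_module M N"
  have ag: "abelian_group (P i)" if "i \<in> I" for i using P[OF that] by (simp add: module_def)
  have am: "abelian_monoid (P i)" if "i \<in> I" for i using ag[OF that] by (simp add: abelian_group_def)
  have subN: "submodule N A M"
  proof (rule M.submoduleI)
    show "\<ominus>\<^bsub>M\<^esub> a \<in> N" if "a \<in> N" for a
      using that module_hom_minus[OF R M P] by (auto simp: N abelian_group.a_inv_closed
          intro!: abelian_group.minus_equality[OF ag] abelian_monoid.l_zero[OF am] abelian_monoid.zero_closed[OF am])
    show "\<zero>\<^bsub>M\<^esub> \<in> N" using module_hom_zero[OF R M P] by (auto simp: N)
    show "c \<odot>\<^bsub>M\<^esub> x \<in> N" if "c \<in> carrier A" "x \<in> N" for c x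
      using that by (auto simp: N module_hom_smult[OF R] module.smult_r_null[OF P])
    show "x \<oplus>\<^bsub>M\<^esub> y \<in> N" if "x \<in> N" "y \<in> N" for x y
      using that by (auto simp: N module_hom_add[OF R]
          intro!: abelian_monoid.l_zero[OF am] abelian_monoid.zero_closed[OF am])
  qed (auto simp: N)
  have Q: "module A ?Q" and cos: "(\<lambda>x. N +>\<^bsub>M\<^esub> x) \<in> module_hom A M ?Q"
    using module_quotient_module[OF M subN] coset_module_hom[OF M subN] by auto
  define T where "T = (\<lambda>\<phi>. \<Oplus>\<^bsub>M\<^esub>i\<in>I. S i (\<phi> i))"
  have S': "(\<lambda>i. S i (\<phi> i)) \<in> I \<rightarrow> carrier M" if "\<phi> \<in> carrier ?DS" for \<phi>
    using that by (auto intro!: S DS.apply_mem)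
  have T: "T \<phi> \<in> carrier M" if "\<phi> \<in> carrier ?DS" for \<phi>
    unfolding T_def using S'[OF that] by (rule M.finsum_closed)
  \<comment> \<open>Applying \<open>R j\<close> annihilates every summand of \<open>T \<phi>\<close>
    except the one with index \<open>j\<close>, so \<open>T\<close> is a section of all the
    \<open>R j\<close> simultaneously.\<close>
  have RT: "R j (T \<phi>) = \<phi> j" if "\<phi> \<in> carrier ?DS" "j \<in> I" for \<phi> j
  proof -
    interpret Pj: module A "P j" using P that by simp
    have "R j (T \<phi>) = (\<Oplus>\<^bsub>P j\<^esub>i\<in>I. R j (S i (\<phi> i)))"
      unfolding T_def using that by (intro module_hom_finsum[OF R M P] S')
    also have "\<dots> = (\<Oplus>\<^bsub>P j\<^esub>i\<in>I. if j = i then \<phi> j else \<zero>\<^bsub>P j\<^esub>)"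
      using that by (intro Pj.finsum_cong') (auto simp: RS DS.apply_mem)
    also have "\<dots> = \<phi> j"
      using that fin by (subst Pj.finsum_singleton) (auto simp: DS.apply_mem)
    finally show ?thesis .
  qed
  have eqT: "(\<Oplus>\<^bsub>?Q\<^esub>i\<in>I. N +>\<^bsub>M\<^esub> S i (\<phi> i)) = N +>\<^bsub>M\<^esub> T \<phi>" if "\<phi> \<in> carrier ?DS" for \<phi>
    unfolding T_def using module_hom_finsum[OF cos M Q S'[OF that]] by simp
  \<comment> \<open>The family of the \<open>R i\<close> is injective on the quotient by its common
    kernel. Additivity, homogeneity, injectivity and surjectivity of the map on cosets are all
    reduced by this to identities between values of the \<open>R i\<close>, where \<open>RT\<close>
    applies.\<close>
  have coset_eq: "N +>\<^bsub>M\<^esub> x = N +>\<^bsub>M\<^esub> y \<longleftrightarrow> (\<forall>i\<in>I. R i x = R i y)"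
    if x: "x \<in> carrier M" and y: "y \<in> carrier M" for x y
  proof -
    have "R i (x \<ominus>\<^bsub>M\<^esub> y) = \<zero>\<^bsub>P i\<^esub> \<longleftrightarrow> R i x = R i y" if i: "i \<in> I" for i
    proof -
      interpret Pi: module A "P i" using P i .
      show ?thesis
        using x y i by (simp add: M.M.minus_eq module_hom_add[OF R] module_hom_minus[OF R M P]
          module_hom_closed[OF R] Pi.M.add.inv_solve_right')
    qed
    then show ?thesis using M.a_coset_eq_iff[OF subN x y] x y by (simp add: N)
  qed
  have DS: "module A ?DS" by (rule DS.is_module)
  then interpret DSm: module A ?DS .
  have cosT_add: "N +>\<^bsub>M\<^esub> T (\<phi> \<oplus>\<^bsub>?DS\<^esub> \<psi>) = (N +>\<^bsub>M\<^esub> T \<phi>) <+>\<^bsub>M\<^esub> (N +>\<^bsub>M\<^esub> T \<psi>)"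
    if "\<phi> \<in> carrier ?DS" "\<psi> \<in> carrier ?DS" for \<phi> \<psi>
  proof -
    have "N +>\<^bsub>M\<^esub> T (\<phi> \<oplus>\<^bsub>?DS\<^esub> \<psi>) = N +>\<^bsub>M\<^esub> (T \<phi> \<oplus>\<^bsub>M\<^esub> T \<psi>)"
      using that by (subst coset_eq) (auto simp: T RT module_hom_add[OF R] DS.add_eq[THEN fun_cong])
    then show ?thesis using module_hom_add[OF cos T T] that by simp
  qed
  have cosT_smult: "N +>\<^bsub>M\<^esub> T (c \<odot>\<^bsub>?DS\<^esub> \<phi>) = c \<odot>\<^bsub>?Q\<^esub> (N +>\<^bsub>M\<^esub> T \<phi>)"
    if "c \<in> carrier A" "\<phi> \<in> carrier ?DS" for c \<phi>
  proof -
    have "N +>\<^bsub>M\<^esub> T (c \<odot>\<^bsub>?DS\<^esub> \<phi>) = N +>\<^bsub>M\<^esub> (c \<odot>\<^bsub>M\<^esub> T \<phi>)"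
      using that by (subst coset_eq) (auto simp: T RT module_hom_smult[OF R] DS.smult_eq[THEN fun_cong])
    then show ?thesis using module_hom_smult[OF cos _ T] that by simp
  qed
  have "bij_betw (\<lambda>\<phi>. N +>\<^bsub>M\<^esub> T \<phi>) (carrier ?DS) (carrier ?Q)"
    unfolding bij_betw_def
  proof
    show "inj_on (\<lambda>\<phi>. N +>\<^bsub>M\<^esub> T \<phi>) (carrier ?DS)"
      by (auto intro!: inj_onI DS.eqI simp: coset_eq T RT)
    have "\<exists>\<phi>\<in>carrier ?DS. N +>\<^bsub>M\<^esub> m = N +>\<^bsub>M\<^esub> T \<phi>" if m: "m \<in> carrier M" for m
    proof
      \<comment> \<open>The preimage of the coset of \<open>m\<close> is the family of its
        restrictions; as \<open>I\<close> is finite, the support condition of the direct sum is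
        automatic.\<close>
      let ?\<phi> = "\<lambda>i\<in>I. R i m"
      show \<phi>: "?\<phi> \<in> carrier ?DS"
        using m fin by (auto simp: direct_sum_module_def module_hom_closed[OF R])
      show "N +>\<^bsub>M\<^esub> m = N +>\<^bsub>M\<^esub> T ?\<phi>"
        using m \<phi> by (subst coset_eq) (auto simp: T RT)
    qed
    then show "(\<lambda>\<phi>. N +>\<^bsub>M\<^esub> T \<phi>) ` carrier ?DS = carrier ?Q"
      by (auto simp: A_RCOSETS_def' intro: T)
  qed
  then have "bij_betw (\<lambda>\<phi>. \<Oplus>\<^bsub>?Q\<^esub>i\<in>I. N +>\<^bsub>M\<^esub> S i (\<phi> i)) (carrier ?DS) (carrier ?Q)"
    by (subst bij_betw_cong[OF eqT])
  then show ?thesis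
    using DS Q
    by (auto simp: module_iso_def iso_def hom_def eqT DS.add_mem DS.smult_mem cosT_add cosT_smult
        module_hom_closed[OF cos T, simplified])
qed

section \<open>Derivations and cocycles\<close>

lemma (in abelian_monoid) finsum_swap:
  assumes "finite S" "finite T" "\<And>x y. x \<in> S \<Longrightarrow> y \<in> T \<Longrightarrow> f x y \<in> carrier G"
  shows "(\<Oplus>x\<in>S. \<Oplus>y\<in>T. f x y) = (\<Oplus>y\<in>T. \<Oplus>x\<in>S. f x y)"
  using assms(1,3)
proof (induction S rule: finite_induct)
  case empty
  then show ?case by (simp add: finsum_zero)
next
  case (insert a S)
  then have "(\<Oplus>x\<in>insert a S. \<Oplus>y\<in>T. f x y) = (\<Oplus>y\<in>T. f a y) \<oplus> (\<Oplus>y\<in>T. \<Oplus>x\<in>S. f x y)"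
    by (subst finsum_insert) (auto intro!: finsum_closed)
  also have "\<dots> = (\<Oplus>y\<in>T. f a y \<oplus> (\<Oplus>x\<in>S. f x y))"
    using insert by (subst finsum_addf) (auto intro!: finsum_closed)
  also have "\<dots> = (\<Oplus>y\<in>T. \<Oplus>x\<in>insert a S. f x y)"
    using insert by (intro finsum_cong') (auto intro!: finsum_closed simp: finsum_insert Pi_def)
  finally show ?case .
qed

lemma (in abelian_group) finsum_minus:
  assumes "f \<in> F \<rightarrow> carrier G" "g \<in> F \<rightarrow> carrier G"
  shows "(\<Oplus>x\<in>F. f x \<ominus> g x) = finsum G f F \<ominus> finsum G g F"
proof -
  have "(\<Oplus>x\<in>F. f x \<ominus> g x) \<oplus> finsum G g F = (\<Oplus>x\<in>F. f x \<ominus> g x \<oplus> g x)"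
    using assms by (subst finsum_addf) auto
  also have "\<dots> = finsum G f F"
    using assms by (intro finsum_cong') (auto simp: minus_eq a_assoc l_neg Pi_iff)
  finally show ?thesis
    using assms add.inv_solve_right[of "\<Oplus>x\<in>F. f x \<ominus> g x" "finsum G f F" "finsum G g F"]
    by (simp add: minus_eq Pi_def)
qed

locale finite_group_algebra = G?: group G + A?: cring A
  for G :: "('g, 'h) monoid_scheme" and A :: "('a, 'k) ring_scheme" +
  assumes finite_carrier: "finite (carrier G)"
begin

abbreviation "GR \<equiv> group_ring A G"
abbreviation "\<delta> \<equiv> gr_basis A G"

lemma inv_mult_cancel [simp]:
  assumes "x \<in> carrier G" "y \<in> carrier G"
  shows "inv\<^bsub>G\<^esub> x \<otimes>\<^bsub>G\<^esub> (x \<otimes>\<^bsub>G\<^esub> y) = y" "x \<otimes>\<^bsub>G\<^esub> (inv\<^bsub>G\<^esub> x \<otimes>\<^bsub>G\<^esub> y) = y"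
  using assms by (simp_all flip: G.m_assoc)

lemma finsum_translate:
  assumes "f \<in> carrier G \<rightarrow> carrier A" "a \<in> carrier G"
  shows "(\<Oplus>\<^bsub>A\<^esub>x\<in>carrier G. f (a \<otimes>\<^bsub>G\<^esub> x)) = (\<Oplus>\<^bsub>A\<^esub>x\<in>carrier G. f x)"
proof -
  have "bij_betw (\<lambda>x. a \<otimes>\<^bsub>G\<^esub> x) (carrier G) (carrier G)"
    by (rule bij_betwI[where g = "\<lambda>x. inv\<^bsub>G\<^esub> a \<otimes>\<^bsub>G\<^esub> x"]) (use assms in \<open>auto\<close>)
  then show ?thesis
    using A.finsum_reindex[of f "\<lambda>x. a \<otimes>\<^bsub>G\<^esub> x" "carrier G"] assms(1) by (simp add: bij_betw_def)
qed

text \<open>Substitution for convolutions: with \<open>g = a * k^-1\<close>, the argument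
  \<open>g^-1 * a\<close> of the second factor becomes \<open>k\<close>.\<close>

lemma finsum_reflect:
  assumes "f \<in> carrier G \<rightarrow> carrier A" "a \<in> carrier G"
  shows "(\<Oplus>\<^bsub>A\<^esub>x\<in>carrier G. f (a \<otimes>\<^bsub>G\<^esub> inv\<^bsub>G\<^esub> x)) = (\<Oplus>\<^bsub>A\<^esub>x\<in>carrier G. f x)"
proof -
  have "bij_betw (\<lambda>x. a \<otimes>\<^bsub>G\<^esub> inv\<^bsub>G\<^esub> x) (carrier G) (carrier G)"
    by (rule bij_betwI[where g = "\<lambda>x. inv\<^bsub>G\<^esub> x \<otimes>\<^bsub>G\<^esub> a"]) (use assms in \<open>auto simp: G.inv_mult_group G.m_assoc\<close>)
  then show ?thesis
    using A.finsum_reindex[of f "\<lambda>x. a \<otimes>\<^bsub>G\<^esub> inv\<^bsub>G\<^esub> x" "carrier G"] assms(1) by (simp add: bij_betw_def)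
qed

section \<open>The group ring and its basis\<close>

lemma GR_simps [simp]:
  "carrier GR = (carrier G \<rightarrow>\<^sub>E carrier A)"
  "\<zero>\<^bsub>GR\<^esub> = (\<lambda>g\<in>carrier G. \<zero>\<^bsub>A\<^esub>)"
  "x \<oplus>\<^bsub>GR\<^esub> y = (\<lambda>g\<in>carrier G. x g \<oplus>\<^bsub>A\<^esub> y g)"
  "c \<odot>\<^bsub>GR\<^esub> x = (\<lambda>g\<in>carrier G. c \<otimes>\<^bsub>A\<^esub> x g)"
  by (simp_all add: group_ring_def)

lemma GR_mult:
  "x \<otimes>\<^bsub>GR\<^esub> y = (\<lambda>g\<in>carrier G. \<Oplus>\<^bsub>A\<^esub>h\<in>carrier G. x h \<otimes>\<^bsub>A\<^esub> y (inv\<^bsub>G\<^esub> h \<otimes>\<^bsub>G\<^esub> g))"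
  by (simp add: group_ring_def)

lemma GR_pointwise: "pointwise_module A (carrier G) (\<lambda>_. regular_module A) GR"
  by (intro pointwise_module.intro pointwise_module_axioms.intro)
    (auto simp: A.is_cring module_regular_module)

lemma GR_module: "module A GR"
  using GR_pointwise by (rule pointwise_module.is_module)

lemma apply_hom: "g \<in> carrier G \<Longrightarrow> (\<lambda>x. x g) \<in> module_hom A GR (regular_module A)"
  using pointwise_module.apply_module_hom[OF GR_pointwise] .

lemma GR_apply_mem: "x \<in> carrier GR \<Longrightarrow> g \<in> carrier G \<Longrightarrow> x g \<in> carrier A"
  by auto

lemma GR_eqI:
  assumes "x \<in> carrier GR" "y \<in> carrier GR" "\<And>g. g \<in> carrier G \<Longrightarrow> x g = y g"
  shows "x = y"
  using pointwise_module.eqI[OF GR_pointwise] assms by blast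

lemma GR_mult_closed: "x \<in> carrier GR \<Longrightarrow> y \<in> carrier GR \<Longrightarrow> x \<otimes>\<^bsub>GR\<^esub> y \<in> carrier GR"
  by (auto simp: GR_mult PiE_iff intro!: A.finsum_closed)

lemma
  assumes "x \<in> carrier GR" "y \<in> carrier GR" "z \<in> carrier GR"
  shows GR_mult_add_left: "(x \<oplus>\<^bsub>GR\<^esub> y) \<otimes>\<^bsub>GR\<^esub> z = x \<otimes>\<^bsub>GR\<^esub> z \<oplus>\<^bsub>GR\<^esub> y \<otimes>\<^bsub>GR\<^esub> z"
    and GR_mult_add_right: "z \<otimes>\<^bsub>GR\<^esub> (x \<oplus>\<^bsub>GR\<^esub> y) = z \<otimes>\<^bsub>GR\<^esub> x \<oplus>\<^bsub>GR\<^esub> z \<otimes>\<^bsub>GR\<^esub> y"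
proof -
  have [simp]: "\<And>g. g \<in> carrier G \<Longrightarrow> x g \<in> carrier A" "\<And>g. g \<in> carrier G \<Longrightarrow> y g \<in> carrier A"
    "\<And>g. g \<in> carrier G \<Longrightarrow> z g \<in> carrier A"
    using assms by auto
  show "(x \<oplus>\<^bsub>GR\<^esub> y) \<otimes>\<^bsub>GR\<^esub> z = x \<otimes>\<^bsub>GR\<^esub> z \<oplus>\<^bsub>GR\<^esub> y \<otimes>\<^bsub>GR\<^esub> z"
    "z \<otimes>\<^bsub>GR\<^esub> (x \<oplus>\<^bsub>GR\<^esub> y) = z \<otimes>\<^bsub>GR\<^esub> x \<oplus>\<^bsub>GR\<^esub> z \<otimes>\<^bsub>GR\<^esub> y"
    by (auto simp: GR_mult fun_eq_iff A.l_distr A.r_distr Pi_def simp flip: A.finsum_addf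
        intro!: A.finsum_cong')
qed

lemma
  assumes "c \<in> carrier A" "x \<in> carrier GR" "y \<in> carrier GR"
  shows GR_smult_mult_left: "(c \<odot>\<^bsub>GR\<^esub> x) \<otimes>\<^bsub>GR\<^esub> y = c \<odot>\<^bsub>GR\<^esub> (x \<otimes>\<^bsub>GR\<^esub> y)"
    and GR_smult_mult_right: "x \<otimes>\<^bsub>GR\<^esub> (c \<odot>\<^bsub>GR\<^esub> y) = c \<odot>\<^bsub>GR\<^esub> (x \<otimes>\<^bsub>GR\<^esub> y)"
proof -
  have [simp]: "\<And>g. g \<in> carrier G \<Longrightarrow> x g \<in> carrier A" "\<And>g. g \<in> carrier G \<Longrightarrow> y g \<in> carrier A"
    using assms by auto
  show "(c \<odot>\<^bsub>GR\<^esub> x) \<otimes>\<^bsub>GR\<^esub> y = c \<odot>\<^bsub>GR\<^esub> (x \<otimes>\<^bsub>GR\<^esub> y)"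
    "x \<otimes>\<^bsub>GR\<^esub> (c \<odot>\<^bsub>GR\<^esub> y) = c \<odot>\<^bsub>GR\<^esub> (x \<otimes>\<^bsub>GR\<^esub> y)"
    using assms(1)
    by (auto simp: GR_mult fun_eq_iff A.m_ac A.finsum_rdistr Pi_def finite_carrier intro!: A.finsum_cong')
qed

lemma basis_mem [simp]: "\<delta> v \<in> carrier GR"
  by (auto simp: gr_basis_def)

lemma basis_apply [simp]: "g \<in> carrier G \<Longrightarrow> \<delta> v g = (if g = v then \<one>\<^bsub>A\<^esub> else \<zero>\<^bsub>A\<^esub>)"
  by (simp add: gr_basis_def)

lemma finsum_single:
  assumes "b \<in> carrier G" "f \<in> carrier G \<rightarrow> carrier A" "\<And>x. x \<in> carrier G \<Longrightarrow> x \<noteq> b \<Longrightarrow> f x = \<zero>\<^bsub>A\<^esub>"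
  shows "(\<Oplus>\<^bsub>A\<^esub>x\<in>carrier G. f x) = f b"
proof -
  have "(\<Oplus>\<^bsub>A\<^esub>x\<in>carrier G. f x) = (\<Oplus>\<^bsub>A\<^esub>x\<in>carrier G. if b = x then f x else \<zero>\<^bsub>A\<^esub>)"
    using assms by (intro A.finsum_cong') auto
  also have "\<dots> = f b"
    using assms finite_carrier by (intro A.finsum_singleton)
  finally show ?thesis .
qed

lemma basis_mult_apply:
  assumes "v \<in> carrier G" "g \<in> carrier G" "x \<in> carrier GR"
  shows "(\<delta> v \<otimes>\<^bsub>GR\<^esub> x) g = x (inv\<^bsub>G\<^esub> v \<otimes>\<^bsub>G\<^esub> g)"
  using assms by (subst GR_mult, simp, subst finsum_single[of v]) (auto simp: PiE_iff)

lemma mult_basis_apply: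
  assumes "v \<in> carrier G" "g \<in> carrier G" "x \<in> carrier GR"
  shows "(x \<otimes>\<^bsub>GR\<^esub> \<delta> v) g = x (g \<otimes>\<^bsub>G\<^esub> inv\<^bsub>G\<^esub> v)"
proof -
  have "inv\<^bsub>G\<^esub> h \<otimes>\<^bsub>G\<^esub> g \<noteq> v" if "h \<in> carrier G" "h \<noteq> g \<otimes>\<^bsub>G\<^esub> inv\<^bsub>G\<^esub> v" for h
    using that assms by (auto simp: G.inv_mult_group G.m_assoc)
  then show ?thesis
    using assms by (subst GR_mult, simp, subst finsum_single[of "g \<otimes>\<^bsub>G\<^esub> inv\<^bsub>G\<^esub> v"])
      (auto simp: PiE_iff G.inv_mult_group G.m_assoc)
qed

lemma basis_mult_basis:
  assumes "h \<in> carrier G" "k \<in> carrier G"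
  shows "\<delta> h \<otimes>\<^bsub>GR\<^esub> \<delta> k = \<delta> (h \<otimes>\<^bsub>G\<^esub> k)"
proof (rule GR_eqI)
  fix g assume g: "g \<in> carrier G"
  have "inv\<^bsub>G\<^esub> h \<otimes>\<^bsub>G\<^esub> g = k \<longleftrightarrow> g = h \<otimes>\<^bsub>G\<^esub> k"
    using g assms by auto
  then show "(\<delta> h \<otimes>\<^bsub>GR\<^esub> \<delta> k) g = \<delta> (h \<otimes>\<^bsub>G\<^esub> k) g"
    using g assms basis_mult_apply[OF _ _ basis_mem] by simp
qed (use GR_mult_closed[OF basis_mem basis_mem] basis_mem in auto)

lemma basis_expansion:
  assumes "x \<in> carrier GR"
  shows "x = (\<Oplus>\<^bsub>GR\<^esub>v\<in>carrier G. x v \<odot>\<^bsub>GR\<^esub> \<delta> v)"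
proof (rule GR_eqI)
  interpret GR: module A GR by (rule GR_module)
  have mem: "(\<lambda>v. x v \<odot>\<^bsub>GR\<^esub> \<delta> v) \<in> carrier G \<rightarrow> carrier GR"
    using assms basis_mem by (intro Pi_I GR.smult_closed GR_apply_mem)
  then show "(\<Oplus>\<^bsub>GR\<^esub>v\<in>carrier G. x v \<odot>\<^bsub>GR\<^esub> \<delta> v) \<in> carrier GR"
    by (rule GR.finsum_closed)
  fix g assume g: "g \<in> carrier G"
  have "(\<Oplus>\<^bsub>GR\<^esub>v\<in>carrier G. x v \<odot>\<^bsub>GR\<^esub> \<delta> v) g = (\<Oplus>\<^bsub>A\<^esub>v\<in>carrier G. (x v \<odot>\<^bsub>GR\<^esub> \<delta> v) g)"
    using module_hom_finsum[OF apply_hom[OF g] GR_module module_regular_module mem] A.is_cring by simp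
  also have "\<dots> = x g"
    using g assms by (subst finsum_single[of g]) (auto simp: PiE_iff)
  finally show "x g = (\<Oplus>\<^bsub>GR\<^esub>v\<in>carrier G. x v \<odot>\<^bsub>GR\<^esub> \<delta> v) g" by simp
qed (use assms in auto)

section \<open>The module of derivations and matrix coefficients\<close>

lemma Der_simps:
  "carrier (Der A G) = derivations A GR"
  "\<zero>\<^bsub>Der A G\<^esub> = (\<lambda>x\<in>carrier GR. \<zero>\<^bsub>GR\<^esub>)"
  "d \<oplus>\<^bsub>Der A G\<^esub> d' = (\<lambda>x\<in>carrier GR. d x \<oplus>\<^bsub>GR\<^esub> d' x)"
  "c \<odot>\<^bsub>Der A G\<^esub> d = (\<lambda>x\<in>carrier GR. c \<odot>\<^bsub>GR\<^esub> d x)"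
  by (simp_all add: Der_def Let_def)

lemma
  assumes "d \<in> carrier (Der A G)"
  shows Der_module_hom: "d \<in> module_hom A GR GR"
    and Der_mult: "x \<in> carrier GR \<Longrightarrow> y \<in> carrier GR \<Longrightarrow>
      d (x \<otimes>\<^bsub>GR\<^esub> y) = d x \<otimes>\<^bsub>GR\<^esub> y \<oplus>\<^bsub>GR\<^esub> x \<otimes>\<^bsub>GR\<^esub> d y"
  using assms by (auto simp: Der_simps derivations_def module_hom_def simp del: GR_simps)

lemma Der_closed: "d \<in> carrier (Der A G) \<Longrightarrow> x \<in> carrier GR \<Longrightarrow> d x \<in> carrier GR"
  using module_hom_closed[OF Der_module_hom] .

lemma Der_pointwise: "pointwise_module A (carrier GR) (\<lambda>_. GR) (Der A G)"
proof -
  interpret GR: module A GR by (rule GR_module)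
  note [simp del] = GR_simps
  note [simp] = GR_mult_closed GR_mult_add_left GR_mult_add_right GR_smult_mult_left
    GR_smult_mult_right
  \<comment> \<open>Only bilinearity of the product is at hand here; products with zero are
    evaluated by pulling the scalar 0 out of a factor \<open>0 * x\<close>.\<close>
  have null: "\<zero>\<^bsub>GR\<^esub> \<otimes>\<^bsub>GR\<^esub> x = \<zero>\<^bsub>GR\<^esub>" "x \<otimes>\<^bsub>GR\<^esub> \<zero>\<^bsub>GR\<^esub> = \<zero>\<^bsub>GR\<^esub>"
    if x: "x \<in> carrier GR" for x
    using GR_smult_mult_left[of "\<zero>\<^bsub>A\<^esub>" x x] GR_smult_mult_right[of "\<zero>\<^bsub>A\<^esub>" x x] x by simp_all
  show ?thesis
  proof (intro pointwise_module.intro pointwise_module_axioms.intro)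
    show "\<zero>\<^bsub>Der A G\<^esub> \<in> carrier (Der A G)"
      by (auto simp: Der_simps derivations_def null)
    show "d \<oplus>\<^bsub>Der A G\<^esub> d' \<in> carrier (Der A G)"
      if d: "d \<in> carrier (Der A G)" and d': "d' \<in> carrier (Der A G)" for d d'
    proof -
      note [simp] = Der_closed[OF d] Der_closed[OF d'] Der_mult[OF d] Der_mult[OF d']
        module_hom_add[OF Der_module_hom[OF d]] module_hom_add[OF Der_module_hom[OF d']]
        module_hom_smult[OF Der_module_hom[OF d]] module_hom_smult[OF Der_module_hom[OF d']]
      show ?thesis
        by (subst Der_simps(1)) (auto simp: Der_simps(3) derivations_def GR.a_ac GR.smult_r_distr)
    qed
    show "c \<odot>\<^bsub>Der A G\<^esub> d \<in> carrier (Der A G)"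
      if c: "c \<in> carrier A" and d: "d \<in> carrier (Der A G)" for c d
    proof -
      note [simp] = c Der_closed[OF d] Der_mult[OF d]
        module_hom_add[OF Der_module_hom[OF d]] module_hom_smult[OF Der_module_hom[OF d]]
      \<comment> \<open>Homogeneity of a multiple of \<open>d\<close> requires two scalars to be
        interchanged, which is where commutativity of \<open>A\<close> enters.\<close>
      show ?thesis
        by (subst Der_simps(1)) (auto simp: Der_simps(4) derivations_def GR.smult_r_distr A.m_comm
            simp flip: GR.smult_assoc1)
    qed
  qed (auto simp: Der_simps derivations_def GR_module A.is_cring)
qed

lemma Der_module: "module A (Der A G)"
  using Der_pointwise by (rule pointwise_module.is_module)

text \<open>For \<open>u\<close> and \<open>v\<close> in the group these functionals are the matrix
  entries of a derivation in the group basis. They separate derivations, by \<open>Der_eqI\<close>,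
  so identities between derivations are checked entry by entry.\<close>

lemma coefficient_module_hom:
  assumes "u \<in> carrier G"
  shows "(\<lambda>d. d (\<delta> v) u) \<in> module_hom A (Der A G) (regular_module A)"
  using pointwise_module.apply_module_hom[OF Der_pointwise basis_mem, of v] apply_hom[OF assms]
  by (auto simp: module_hom_def Pi_iff simp del: GR_simps)

lemma coefficient_mem:
  "d \<in> carrier (Der A G) \<Longrightarrow> u \<in> carrier G \<Longrightarrow> d (\<delta> v) u \<in> carrier A"
  using module_hom_closed[OF coefficient_module_hom] by simp

lemma Der_apply:
  assumes d: "d \<in> carrier (Der A G)" and x: "x \<in> carrier GR" and u: "u \<in> carrier G"
  shows "d x u = (\<Oplus>\<^bsub>A\<^esub>v\<in>carrier G. x v \<otimes>\<^bsub>A\<^esub> d (\<delta> v) u)"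
proof -
  interpret GR: module A GR by (rule GR_module)
  note [simp del] = GR_simps
  have mem: "(\<lambda>v. x v \<odot>\<^bsub>GR\<^esub> \<delta> v) \<in> carrier G \<rightarrow> carrier GR"
    using x basis_mem by (intro Pi_I GR.smult_closed GR_apply_mem)
  have mem': "(\<lambda>v. d (x v \<odot>\<^bsub>GR\<^esub> \<delta> v)) \<in> carrier G \<rightarrow> carrier GR"
    using mem Der_closed[OF d] by auto
  have "d x u = d (\<Oplus>\<^bsub>GR\<^esub>v\<in>carrier G. x v \<odot>\<^bsub>GR\<^esub> \<delta> v) u"
    using basis_expansion[OF x] by simp
  also have "\<dots> = (\<Oplus>\<^bsub>A\<^esub>v\<in>carrier G. d (x v \<odot>\<^bsub>GR\<^esub> \<delta> v) u)"
    using module_hom_finsum[OF Der_module_hom[OF d] GR_module GR_module mem]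
      module_hom_finsum[OF apply_hom[OF u] GR_module module_regular_module[OF A.is_cring] mem']
    by simp
  also have "\<dots> = (\<Oplus>\<^bsub>A\<^esub>v\<in>carrier G. x v \<otimes>\<^bsub>A\<^esub> d (\<delta> v) u)"
    using x u by (intro A.finsum_cong')
      (auto simp: module_hom_smult[OF Der_module_hom[OF d]] module_hom_smult[OF apply_hom]
        Der_closed[OF d] coefficient_mem[OF d] GR_apply_mem)
  finally show ?thesis .
qed

lemma Der_eqI:
  assumes d: "d \<in> carrier (Der A G)" and d': "d' \<in> carrier (Der A G)"
    and eq: "\<And>v u. v \<in> carrier G \<Longrightarrow> u \<in> carrier G \<Longrightarrow> d (\<delta> v) u = d' (\<delta> v) u"
  shows "d = d'"
proof (rule pointwise_module.eqI[OF Der_pointwise d d'])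
  fix x assume x: "x \<in> carrier GR"
  show "d x = d' x"
  proof (rule GR_eqI[OF Der_closed[OF d x] Der_closed[OF d' x]])
    fix u assume u: "u \<in> carrier G"
    show "d x u = d' x u"
      unfolding Der_apply[OF d x u] Der_apply[OF d' x u]
      using eq u x by (intro A.finsum_cong') (auto simp: coefficient_mem[OF d'] PiE_iff)
  qed
qed

section \<open>Derivations as cocycles\<close>

text \<open>The second condition is additivity along composition: \<open>(h, u * k^-1)\<close> ends
  at \<open>h^-1 * u * k^-1\<close>, where \<open>(k, h^-1 * u)\<close> starts, and their composite
  is \<open>(h * k, u)\<close>.\<close>

definition cocycle :: "('g \<Rightarrow> 'g \<Rightarrow> 'a) \<Rightarrow> bool" where
  "cocycle c \<longleftrightarrow>
    (\<forall>v\<in>carrier G. \<forall>u\<in>carrier G. c v u \<in> carrier A) \<and>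
    (\<forall>h\<in>carrier G. \<forall>k\<in>carrier G. \<forall>u\<in>carrier G.
      c (h \<otimes>\<^bsub>G\<^esub> k) u = c h (u \<otimes>\<^bsub>G\<^esub> inv\<^bsub>G\<^esub> k) \<oplus>\<^bsub>A\<^esub> c k (inv\<^bsub>G\<^esub> h \<otimes>\<^bsub>G\<^esub> u))"

lemma
  assumes "cocycle c"
  shows cocycle_mem: "v \<in> carrier G \<Longrightarrow> u \<in> carrier G \<Longrightarrow> c v u \<in> carrier A"
    and cocycle_mult: "h \<in> carrier G \<Longrightarrow> k \<in> carrier G \<Longrightarrow> u \<in> carrier G \<Longrightarrow>
      c (h \<otimes>\<^bsub>G\<^esub> k) u = c h (u \<otimes>\<^bsub>G\<^esub> inv\<^bsub>G\<^esub> k) \<oplus>\<^bsub>A\<^esub> c k (inv\<^bsub>G\<^esub> h \<otimes>\<^bsub>G\<^esub> u)"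
  using assms by (auto simp: cocycle_def)

lemma cocycle_coefficient:
  assumes d: "d \<in> carrier (Der A G)"
  shows "cocycle (\<lambda>v. d (\<delta> v))"
  unfolding cocycle_def
proof (intro conjI ballI)
  fix h k u assume h: "h \<in> carrier G" and k: "k \<in> carrier G" and u: "u \<in> carrier G"
  have "d (\<delta> (h \<otimes>\<^bsub>G\<^esub> k)) = d (\<delta> h) \<otimes>\<^bsub>GR\<^esub> \<delta> k \<oplus>\<^bsub>GR\<^esub> \<delta> h \<otimes>\<^bsub>GR\<^esub> d (\<delta> k)"
    using Der_mult[OF d basis_mem basis_mem] basis_mult_basis[OF h k] by metis
  then show "d (\<delta> (h \<otimes>\<^bsub>G\<^esub> k)) u =
      d (\<delta> h) (u \<otimes>\<^bsub>G\<^esub> inv\<^bsub>G\<^esub> k) \<oplus>\<^bsub>A\<^esub> d (\<delta> k) (inv\<^bsub>G\<^esub> h \<otimes>\<^bsub>G\<^esub> u)"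
    using h k u by (simp add: mult_basis_apply basis_mult_apply Der_closed[OF d basis_mem] del: GR_simps(1))
qed (simp add: coefficient_mem[OF d])

definition derivation_of :: "('g \<Rightarrow> 'g \<Rightarrow> 'a) \<Rightarrow> ('g \<Rightarrow> 'a) \<Rightarrow> 'g \<Rightarrow> 'a" where
  "derivation_of c =
    (\<lambda>x\<in>carrier GR. \<lambda>u\<in>carrier G. \<Oplus>\<^bsub>A\<^esub>v\<in>carrier G. x v \<otimes>\<^bsub>A\<^esub> c v u)"

lemma derivation_of_basis:
  assumes "cocycle c" "v \<in> carrier G" "u \<in> carrier G"
  shows "derivation_of c (\<delta> v) u = c v u"
  using assms basis_mem[of v]
  by (simp add: derivation_of_def del: GR_simps, subst finsum_single[of v]) (auto simp: cocycle_mem)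

text \<open>At a fixed coefficient \<open>u\<close>, each of the three products becomes a double sum
  over \<open>h\<close> and \<open>k\<close> of \<open>x h * y k\<close> times a kernel. The cocycle
  equation is precisely the relation between the three kernels.\<close>

lemma derivation_of_mult:
  assumes c: "cocycle c" and x: "x \<in> carrier GR" and y: "y \<in> carrier GR"
  shows "derivation_of c (x \<otimes>\<^bsub>GR\<^esub> y) =
    derivation_of c x \<otimes>\<^bsub>GR\<^esub> y \<oplus>\<^bsub>GR\<^esub> x \<otimes>\<^bsub>GR\<^esub> derivation_of c y"
proof -
  let ?S = "\<lambda>f. \<Oplus>\<^bsub>A\<^esub>h\<in>carrier G. \<Oplus>\<^bsub>A\<^esub>k\<in>carrier G. x h \<otimes>\<^bsub>A\<^esub> y k \<otimes>\<^bsub>A\<^esub> f h k"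
  have mem [simp]: "x g \<in> carrier A" "y g \<in> carrier A" if "g \<in> carrier G" for g
    using x y that by auto
  note [simp] = cocycle_mem[OF c] finite_carrier
  note [intro!] = A.finsum_closed
  have xy: "x \<otimes>\<^bsub>GR\<^esub> y \<in> carrier GR" by (rule GR_mult_closed[OF x y])
  have prod: "derivation_of c (x \<otimes>\<^bsub>GR\<^esub> y) u = ?S (\<lambda>h k. c (h \<otimes>\<^bsub>G\<^esub> k) u)"
    if u: "u \<in> carrier G" for u
  proof -
    have "derivation_of c (x \<otimes>\<^bsub>GR\<^esub> y) u =
        (\<Oplus>\<^bsub>A\<^esub>v\<in>carrier G. \<Oplus>\<^bsub>A\<^esub>h\<in>carrier G. x h \<otimes>\<^bsub>A\<^esub> y (inv\<^bsub>G\<^esub> h \<otimes>\<^bsub>G\<^esub> v) \<otimes>\<^bsub>A\<^esub> c v u)"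
      using xy u by (auto simp: derivation_of_def GR_mult A.finsum_ldistr Pi_def intro!: A.finsum_cong')
    also have "\<dots> = (\<Oplus>\<^bsub>A\<^esub>h\<in>carrier G. \<Oplus>\<^bsub>A\<^esub>v\<in>carrier G. x h \<otimes>\<^bsub>A\<^esub> y (inv\<^bsub>G\<^esub> h \<otimes>\<^bsub>G\<^esub> v) \<otimes>\<^bsub>A\<^esub> c v u)"
      using u by (intro A.finsum_swap) auto
    also have "\<dots> = ?S (\<lambda>h k. c (h \<otimes>\<^bsub>G\<^esub> k) u)"
    proof (rule A.finsum_cong'[OF refl])
      fix h assume h: "h \<in> carrier G"
      \<comment> \<open>Substitution \<open>v = h * k\<close> for fixed \<open>h\<close>, which
        turns \<open>y (h^-1 * v)\<close> into \<open>y k\<close>.\<close>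
      have "(\<Oplus>\<^bsub>A\<^esub>k\<in>carrier G. x h \<otimes>\<^bsub>A\<^esub> y k \<otimes>\<^bsub>A\<^esub> c (h \<otimes>\<^bsub>G\<^esub> k) u) = (\<Oplus>\<^bsub>A\<^esub>k\<in>carrier G.
            x h \<otimes>\<^bsub>A\<^esub> y (inv\<^bsub>G\<^esub> h \<otimes>\<^bsub>G\<^esub> (h \<otimes>\<^bsub>G\<^esub> k)) \<otimes>\<^bsub>A\<^esub> c (h \<otimes>\<^bsub>G\<^esub> k) u)"
        using h u by (intro A.finsum_cong') auto
      then show "(\<Oplus>\<^bsub>A\<^esub>v\<in>carrier G. x h \<otimes>\<^bsub>A\<^esub> y (inv\<^bsub>G\<^esub> h \<otimes>\<^bsub>G\<^esub> v) \<otimes>\<^bsub>A\<^esub> c v u) =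
          (\<Oplus>\<^bsub>A\<^esub>k\<in>carrier G. x h \<otimes>\<^bsub>A\<^esub> y k \<otimes>\<^bsub>A\<^esub> c (h \<otimes>\<^bsub>G\<^esub> k) u)"
        using finsum_translate[of "\<lambda>v. x h \<otimes>\<^bsub>A\<^esub> y (inv\<^bsub>G\<^esub> h \<otimes>\<^bsub>G\<^esub> v) \<otimes>\<^bsub>A\<^esub> c v u" h] h u
        by (simp add: Pi_def)
    qed (use u in auto)
    finally show ?thesis .
  qed
  have left: "(derivation_of c x \<otimes>\<^bsub>GR\<^esub> y) u = ?S (\<lambda>h k. c h (u \<otimes>\<^bsub>G\<^esub> inv\<^bsub>G\<^esub> k))"
    if u: "u \<in> carrier G" for u
  proof -
    have "(derivation_of c x \<otimes>\<^bsub>GR\<^esub> y) u =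
        (\<Oplus>\<^bsub>A\<^esub>g\<in>carrier G. \<Oplus>\<^bsub>A\<^esub>h\<in>carrier G. x h \<otimes>\<^bsub>A\<^esub> c h g \<otimes>\<^bsub>A\<^esub> y (inv\<^bsub>G\<^esub> g \<otimes>\<^bsub>G\<^esub> u))"
      using x u by (auto simp: derivation_of_def GR_mult A.finsum_ldistr Pi_def intro!: A.finsum_cong')
    also have "\<dots> = (\<Oplus>\<^bsub>A\<^esub>h\<in>carrier G. \<Oplus>\<^bsub>A\<^esub>g\<in>carrier G. x h \<otimes>\<^bsub>A\<^esub> c h g \<otimes>\<^bsub>A\<^esub> y (inv\<^bsub>G\<^esub> g \<otimes>\<^bsub>G\<^esub> u))"
      using u by (intro A.finsum_swap) auto
    also have "\<dots> = ?S (\<lambda>h k. c h (u \<otimes>\<^bsub>G\<^esub> inv\<^bsub>G\<^esub> k))"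
    proof (rule A.finsum_cong'[OF refl])
      fix h assume h: "h \<in> carrier G"
      \<comment> \<open>Substitution \<open>g = u * k^-1\<close>, after which \<open>y\<close> is
        evaluated at the summation variable \<open>k\<close>.\<close>
      have "(\<Oplus>\<^bsub>A\<^esub>g\<in>carrier G. x h \<otimes>\<^bsub>A\<^esub> c h g \<otimes>\<^bsub>A\<^esub> y (inv\<^bsub>G\<^esub> g \<otimes>\<^bsub>G\<^esub> u)) =
          (\<Oplus>\<^bsub>A\<^esub>k\<in>carrier G. x h \<otimes>\<^bsub>A\<^esub> c h (u \<otimes>\<^bsub>G\<^esub> inv\<^bsub>G\<^esub> k) \<otimes>\<^bsub>A\<^esub>
            y (inv\<^bsub>G\<^esub> (u \<otimes>\<^bsub>G\<^esub> inv\<^bsub>G\<^esub> k) \<otimes>\<^bsub>G\<^esub> u))"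
        using finsum_reflect[of "\<lambda>g. x h \<otimes>\<^bsub>A\<^esub> c h g \<otimes>\<^bsub>A\<^esub> y (inv\<^bsub>G\<^esub> g \<otimes>\<^bsub>G\<^esub> u)" u] h u
        by (simp add: Pi_def)
      also have "\<dots> = (\<Oplus>\<^bsub>A\<^esub>k\<in>carrier G. x h \<otimes>\<^bsub>A\<^esub> y k \<otimes>\<^bsub>A\<^esub> c h (u \<otimes>\<^bsub>G\<^esub> inv\<^bsub>G\<^esub> k))"
        using h u by (intro A.finsum_cong') (auto simp: G.inv_mult_group G.m_assoc A.m_ac)
      finally show "(\<Oplus>\<^bsub>A\<^esub>g\<in>carrier G. x h \<otimes>\<^bsub>A\<^esub> c h g \<otimes>\<^bsub>A\<^esub> y (inv\<^bsub>G\<^esub> g \<otimes>\<^bsub>G\<^esub> u)) =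
          (\<Oplus>\<^bsub>A\<^esub>k\<in>carrier G. x h \<otimes>\<^bsub>A\<^esub> y k \<otimes>\<^bsub>A\<^esub> c h (u \<otimes>\<^bsub>G\<^esub> inv\<^bsub>G\<^esub> k))" .
    qed (use u in auto)
    finally show ?thesis .
  qed
  \<comment> \<open>The convolution already runs over \<open>h\<close> and the expansion of
    \<open>derivation_of c y\<close> over \<open>k\<close>, so expanding the product
    suffices.\<close>
  have right: "(x \<otimes>\<^bsub>GR\<^esub> derivation_of c y) u = ?S (\<lambda>h k. c k (inv\<^bsub>G\<^esub> h \<otimes>\<^bsub>G\<^esub> u))"
    if u: "u \<in> carrier G" for u
    using y u by (auto simp: derivation_of_def GR_mult A.finsum_rdistr A.m_assoc Pi_def intro!: A.finsum_cong')
  have closed: "derivation_of c z \<in> carrier GR" if "z \<in> carrier GR" for z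
    using that by (auto simp: derivation_of_def)
  show ?thesis
  proof (rule GR_eqI)
    fix u assume u: "u \<in> carrier G"
    have "?S (\<lambda>h k. c (h \<otimes>\<^bsub>G\<^esub> k) u) = (\<Oplus>\<^bsub>A\<^esub>h\<in>carrier G. \<Oplus>\<^bsub>A\<^esub>k\<in>carrier G.
        x h \<otimes>\<^bsub>A\<^esub> y k \<otimes>\<^bsub>A\<^esub> c h (u \<otimes>\<^bsub>G\<^esub> inv\<^bsub>G\<^esub> k) \<oplus>\<^bsub>A\<^esub>
        x h \<otimes>\<^bsub>A\<^esub> y k \<otimes>\<^bsub>A\<^esub> c k (inv\<^bsub>G\<^esub> h \<otimes>\<^bsub>G\<^esub> u))"
      using u by (intro A.finsum_cong') (auto simp: cocycle_mult[OF c] A.r_distr)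
    also have "\<dots> = (\<Oplus>\<^bsub>A\<^esub>h\<in>carrier G.
        (\<Oplus>\<^bsub>A\<^esub>k\<in>carrier G. x h \<otimes>\<^bsub>A\<^esub> y k \<otimes>\<^bsub>A\<^esub> c h (u \<otimes>\<^bsub>G\<^esub> inv\<^bsub>G\<^esub> k)) \<oplus>\<^bsub>A\<^esub>
        (\<Oplus>\<^bsub>A\<^esub>k\<in>carrier G. x h \<otimes>\<^bsub>A\<^esub> y k \<otimes>\<^bsub>A\<^esub> c k (inv\<^bsub>G\<^esub> h \<otimes>\<^bsub>G\<^esub> u)))"
      by (rule A.finsum_cong'[OF refl]) (use u in \<open>auto simp: A.finsum_addf Pi_def\<close>)
    also have "\<dots> = ?S (\<lambda>h k. c h (u \<otimes>\<^bsub>G\<^esub> inv\<^bsub>G\<^esub> k)) \<oplus>\<^bsub>A\<^esub> ?S (\<lambda>h k. c k (inv\<^bsub>G\<^esub> h \<otimes>\<^bsub>G\<^esub> u))"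
      using u by (subst A.finsum_addf) auto
    finally show "derivation_of c (x \<otimes>\<^bsub>GR\<^esub> y) u =
        (derivation_of c x \<otimes>\<^bsub>GR\<^esub> y \<oplus>\<^bsub>GR\<^esub> x \<otimes>\<^bsub>GR\<^esub> derivation_of c y) u"
      using u by (simp add: prod left right)
  next
    interpret GR: module A GR by (rule GR_module)
    show "derivation_of c x \<otimes>\<^bsub>GR\<^esub> y \<oplus>\<^bsub>GR\<^esub> x \<otimes>\<^bsub>GR\<^esub> derivation_of c y \<in> carrier GR"
      by (intro GR.a_closed GR_mult_closed closed x y)
  qed (rule closed[OF xy])
qed

lemma derivation_of_mem:
  assumes c: "cocycle c"
  shows "derivation_of c \<in> carrier (Der A G)"
proof -
  interpret GR: module A GR by (rule GR_module)
  have "derivation_of c \<in> carrier GR \<rightarrow>\<^sub>E carrier GR"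
    by (auto simp: derivation_of_def cocycle_mem[OF c] PiE_iff intro!: A.finsum_closed)
  moreover have "derivation_of c (x \<oplus>\<^bsub>GR\<^esub> y) = derivation_of c x \<oplus>\<^bsub>GR\<^esub> derivation_of c y"
    if x: "x \<in> carrier GR" and y: "y \<in> carrier GR" for x y
  proof -
    have "x \<oplus>\<^bsub>GR\<^esub> y \<in> carrier GR" using x y by (rule GR.a_closed)
    then show ?thesis
      using x y by (auto simp: derivation_of_def fun_eq_iff cocycle_mem[OF c] PiE_iff A.l_distr Pi_def
          simp flip: A.finsum_addf intro!: A.finsum_cong')
  qed
  moreover have "derivation_of c (r \<odot>\<^bsub>GR\<^esub> x) = r \<odot>\<^bsub>GR\<^esub> derivation_of c x"
    if r: "r \<in> carrier A" and x: "x \<in> carrier GR" for r x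
  proof -
    have "r \<odot>\<^bsub>GR\<^esub> x \<in> carrier GR" using r x by (rule GR.smult_closed)
    then show ?thesis
      using r x by (auto simp: derivation_of_def fun_eq_iff cocycle_mem[OF c] PiE_iff A.m_assoc Pi_def
          A.finsum_rdistr finite_carrier intro!: A.finsum_cong')
  qed
  ultimately show ?thesis
    using derivation_of_mult[OF c] by (simp add: Der_simps derivations_def del: GR_simps)
qed

section \<open>Inner derivations as coboundaries\<close>

text \<open>The potential at the source of the arrow \<open>(v, u)\<close> minus the potential at
  its target. This sign makes it the coefficient of \<open>u\<close> in
  \<open>f * v - v * f\<close>, in agreement with \<open>ad\<close>.\<close>

definition coboundary :: "('g \<Rightarrow> 'a) \<Rightarrow> 'g \<Rightarrow> 'g \<Rightarrow> 'a" where
  "coboundary f v u = f (u \<otimes>\<^bsub>G\<^esub> inv\<^bsub>G\<^esub> v) \<ominus>\<^bsub>A\<^esub> f (inv\<^bsub>G\<^esub> v \<otimes>\<^bsub>G\<^esub> u)"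

text \<open>Potential differences telescope through the intermediate object
  \<open>h^-1 * u * k^-1\<close>.\<close>

lemma cocycle_coboundary:
  assumes "f \<in> carrier G \<rightarrow> carrier A"
  shows "cocycle (coboundary f)"
  unfolding cocycle_def
proof (intro conjI ballI)
  fix h k u assume hku: "h \<in> carrier G" "k \<in> carrier G" "u \<in> carrier G"
  have [simp]: "f g \<in> carrier A" if "g \<in> carrier G" for g using that assms by auto
  have cancel: "p \<ominus>\<^bsub>A\<^esub> r = (p \<ominus>\<^bsub>A\<^esub> q) \<oplus>\<^bsub>A\<^esub> (q \<ominus>\<^bsub>A\<^esub> r)"
    if "p \<in> carrier A" "q \<in> carrier A" "r \<in> carrier A" for p q r
    using that by (simp add: A.minus_eq A.a_assoc A.r_neg1)
  show "coboundary f (h \<otimes>\<^bsub>G\<^esub> k) u =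
      coboundary f h (u \<otimes>\<^bsub>G\<^esub> inv\<^bsub>G\<^esub> k) \<oplus>\<^bsub>A\<^esub> coboundary f k (inv\<^bsub>G\<^esub> h \<otimes>\<^bsub>G\<^esub> u)"
    using hku cancel[of "f (u \<otimes>\<^bsub>G\<^esub> inv\<^bsub>G\<^esub> (h \<otimes>\<^bsub>G\<^esub> k))" "f (inv\<^bsub>G\<^esub> h \<otimes>\<^bsub>G\<^esub> u \<otimes>\<^bsub>G\<^esub> inv\<^bsub>G\<^esub> k)"
        "f (inv\<^bsub>G\<^esub> (h \<otimes>\<^bsub>G\<^esub> k) \<otimes>\<^bsub>G\<^esub> u)"]
    by (simp add: coboundary_def G.inv_mult_group G.m_assoc)
qed (use assms in \<open>auto simp: coboundary_def\<close>)

lemma ad_eq_derivation_of: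
  assumes f: "f \<in> carrier GR"
  shows "ad A G f = derivation_of (coboundary f)"
proof -
  interpret GR: module A GR by (rule GR_module)
  have [simp]: "f g \<in> carrier A" if "g \<in> carrier G" for g using that f by auto
  have "(f \<otimes>\<^bsub>GR\<^esub> x \<ominus>\<^bsub>GR\<^esub> x \<otimes>\<^bsub>GR\<^esub> f) u =
      (\<Oplus>\<^bsub>A\<^esub>v\<in>carrier G. x v \<otimes>\<^bsub>A\<^esub> coboundary f v u)"
    if x: "x \<in> carrier GR" and u: "u \<in> carrier G" for x u
  proof -
    have [simp]: "x g \<in> carrier A" if "g \<in> carrier G" for g using that x by auto
    note mem = GR_mult_closed[OF f x] GR_mult_closed[OF x f]
    \<comment> \<open>The convolution is reflected so that \<open>x\<close> is evaluated at the
      summation variable. Both products then are sums over \<open>v\<close> weighted by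
      \<open>x v\<close> and can be subtracted term by term.\<close>
    have "(f \<otimes>\<^bsub>GR\<^esub> x) u = (\<Oplus>\<^bsub>A\<^esub>v\<in>carrier G. f (u \<otimes>\<^bsub>G\<^esub> inv\<^bsub>G\<^esub> v) \<otimes>\<^bsub>A\<^esub>
        x (inv\<^bsub>G\<^esub> (u \<otimes>\<^bsub>G\<^esub> inv\<^bsub>G\<^esub> v) \<otimes>\<^bsub>G\<^esub> u))"
      using finsum_reflect[of "\<lambda>g. f g \<otimes>\<^bsub>A\<^esub> x (inv\<^bsub>G\<^esub> g \<otimes>\<^bsub>G\<^esub> u)" u] u
      by (simp add: GR_mult Pi_def)
    also have "\<dots> = (\<Oplus>\<^bsub>A\<^esub>v\<in>carrier G. x v \<otimes>\<^bsub>A\<^esub> f (u \<otimes>\<^bsub>G\<^esub> inv\<^bsub>G\<^esub> v))"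
      using u by (intro A.finsum_cong') (auto simp: G.inv_mult_group G.m_assoc A.m_comm)
    finally have left: "(f \<otimes>\<^bsub>GR\<^esub> x) u = (\<Oplus>\<^bsub>A\<^esub>v\<in>carrier G. x v \<otimes>\<^bsub>A\<^esub> f (u \<otimes>\<^bsub>G\<^esub> inv\<^bsub>G\<^esub> v))" .
    have right: "(x \<otimes>\<^bsub>GR\<^esub> f) u = (\<Oplus>\<^bsub>A\<^esub>v\<in>carrier G. x v \<otimes>\<^bsub>A\<^esub> f (inv\<^bsub>G\<^esub> v \<otimes>\<^bsub>G\<^esub> u))"
      using u by (simp add: GR_mult)
    have "(f \<otimes>\<^bsub>GR\<^esub> x \<ominus>\<^bsub>GR\<^esub> x \<otimes>\<^bsub>GR\<^esub> f) u = (f \<otimes>\<^bsub>GR\<^esub> x) u \<ominus>\<^bsub>A\<^esub> (x \<otimes>\<^bsub>GR\<^esub> f) u"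
      using u mem module_hom_minus[OF apply_hom[OF u] GR_module module_regular_module[OF A.is_cring] mem(2)]
        module_hom_add[OF apply_hom[OF u] mem(1) GR.a_inv_closed[OF mem(2)]]
      by (simp add: GR.minus_eq A.minus_eq del: GR_simps)
    also have "\<dots> = (\<Oplus>\<^bsub>A\<^esub>v\<in>carrier G. x v \<otimes>\<^bsub>A\<^esub> f (u \<otimes>\<^bsub>G\<^esub> inv\<^bsub>G\<^esub> v) \<ominus>\<^bsub>A\<^esub>
        x v \<otimes>\<^bsub>A\<^esub> f (inv\<^bsub>G\<^esub> v \<otimes>\<^bsub>G\<^esub> u))"
      using u right by (subst A.finsum_minus) (simp_all add: left Pi_def)
    also have "\<dots> = (\<Oplus>\<^bsub>A\<^esub>v\<in>carrier G. x v \<otimes>\<^bsub>A\<^esub> coboundary f v u)"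
      using u by (intro A.finsum_cong') (auto simp: coboundary_def A.minus_eq A.r_distr A.r_minus)
    finally show ?thesis .
  qed
  \<comment> \<open>The identity just shown concerns coefficients inside the group; extensionality
    settles the values elsewhere, so that both sides agree as functions.\<close>
  moreover have "f \<otimes>\<^bsub>GR\<^esub> x \<ominus>\<^bsub>GR\<^esub> x \<otimes>\<^bsub>GR\<^esub> f \<in> extensional (carrier G)"
    if x: "x \<in> carrier GR" for x
    using GR.minus_closed[OF GR_mult_closed[OF f x] GR_mult_closed[OF x f]] by (simp add: PiE_iff)
  ultimately show ?thesis
    by (auto simp: ad_def Let_def derivation_of_def fun_eq_iff extensional_def simp del: GR_simps)
qed

text \<open>By linearity of \<open>ad\<close>, the coefficients in a combination of the derivations
  \<open>ad\<close> at group elements serve as the potential themselves. The comparison is made on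
  matrix entries.\<close>

lemma Inn_eq: "Inn A G = {derivation_of (coboundary C) | C. C \<in> carrier G \<rightarrow> carrier A}"
proof -
  interpret Der: module A "Der A G" by (rule Der_module)
  have "(\<Oplus>\<^bsub>Der A G\<^esub>a\<in>carrier G. C a \<odot>\<^bsub>Der A G\<^esub> ad A G (\<delta> a)) = derivation_of (coboundary C)"
    if C: "C \<in> carrier G \<rightarrow> carrier A" for C
  proof (rule Der_eqI)
    have [simp]: "C g \<in> carrier A" if "g \<in> carrier G" for g using that C by auto
    have \<delta>: "\<delta> a \<in> carrier G \<rightarrow> carrier A" for a by (auto simp: gr_basis_def)
    have ad: "ad A G (\<delta> a) \<in> carrier (Der A G)" for a
      using derivation_of_mem[OF cocycle_coboundary[OF \<delta>]] ad_eq_derivation_of[OF basis_mem] by simp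
    then have mem: "(\<lambda>a. C a \<odot>\<^bsub>Der A G\<^esub> ad A G (\<delta> a)) \<in> carrier G \<rightarrow> carrier (Der A G)"
      by auto
    then show "(\<Oplus>\<^bsub>Der A G\<^esub>a\<in>carrier G. C a \<odot>\<^bsub>Der A G\<^esub> ad A G (\<delta> a)) \<in> carrier (Der A G)"
      by (rule Der.finsum_closed)
    show "derivation_of (coboundary C) \<in> carrier (Der A G)"
      using C by (intro derivation_of_mem cocycle_coboundary)
    fix v u assume v: "v \<in> carrier G" and u: "u \<in> carrier G"
    have "(\<Oplus>\<^bsub>Der A G\<^esub>a\<in>carrier G. C a \<odot>\<^bsub>Der A G\<^esub> ad A G (\<delta> a)) (\<delta> v) u =
        (\<Oplus>\<^bsub>A\<^esub>a\<in>carrier G. (C a \<odot>\<^bsub>Der A G\<^esub> ad A G (\<delta> a)) (\<delta> v) u)"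
      using module_hom_finsum[OF coefficient_module_hom[OF u] Der_module module_regular_module mem]
        A.is_cring by simp
    also have "\<dots> = (\<Oplus>\<^bsub>A\<^esub>a\<in>carrier G. C a \<otimes>\<^bsub>A\<^esub> \<delta> a (u \<otimes>\<^bsub>G\<^esub> inv\<^bsub>G\<^esub> v) \<ominus>\<^bsub>A\<^esub>
        C a \<otimes>\<^bsub>A\<^esub> \<delta> a (inv\<^bsub>G\<^esub> v \<otimes>\<^bsub>G\<^esub> u))"
    proof (rule A.finsum_cong'[OF refl])
      fix a assume a: "a \<in> carrier G"
      have "(C a \<odot>\<^bsub>Der A G\<^esub> ad A G (\<delta> a)) (\<delta> v) u = C a \<otimes>\<^bsub>A\<^esub> coboundary (\<delta> a) v u"
        using a u v ad module_hom_smult[OF coefficient_module_hom[OF u]]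
        by (simp add: ad_eq_derivation_of[OF basis_mem] derivation_of_basis[OF cocycle_coboundary[OF \<delta>]])
      also have "\<dots> = C a \<otimes>\<^bsub>A\<^esub> \<delta> a (u \<otimes>\<^bsub>G\<^esub> inv\<^bsub>G\<^esub> v) \<ominus>\<^bsub>A\<^esub> C a \<otimes>\<^bsub>A\<^esub> \<delta> a (inv\<^bsub>G\<^esub> v \<otimes>\<^bsub>G\<^esub> u)"
        using a u v funcset_mem[OF \<delta>]
        by (simp add: coboundary_def A.minus_eq A.r_distr A.r_minus del: basis_apply)
      finally show "(C a \<odot>\<^bsub>Der A G\<^esub> ad A G (\<delta> a)) (\<delta> v) u = \<dots>" .
    qed (use u v in auto)
    also have "\<dots> = (\<Oplus>\<^bsub>A\<^esub>a\<in>carrier G. C a \<otimes>\<^bsub>A\<^esub> \<delta> a (u \<otimes>\<^bsub>G\<^esub> inv\<^bsub>G\<^esub> v)) \<ominus>\<^bsub>A\<^esub>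
        (\<Oplus>\<^bsub>A\<^esub>a\<in>carrier G. C a \<otimes>\<^bsub>A\<^esub> \<delta> a (inv\<^bsub>G\<^esub> v \<otimes>\<^bsub>G\<^esub> u))"
      using u v by (subst A.finsum_minus) auto
    \<comment> \<open>One term survives in each sum: \<open>a = u * v^-1\<close> in the first and
      \<open>a = v^-1 * u\<close> in the second.\<close>
    also have "\<dots> = coboundary C v u"
      using u v
      by (subst finsum_single[of "u \<otimes>\<^bsub>G\<^esub> inv\<^bsub>G\<^esub> v"], simp, force, force,
          subst finsum_single[of "inv\<^bsub>G\<^esub> v \<otimes>\<^bsub>G\<^esub> u"]) (auto simp: coboundary_def)
    finally show "(\<Oplus>\<^bsub>Der A G\<^esub>a\<in>carrier G. C a \<odot>\<^bsub>Der A G\<^esub> ad A G (\<delta> a)) (\<delta> v) u =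
        derivation_of (coboundary C) (\<delta> v) u"
      using u v C by (simp add: derivation_of_basis cocycle_coboundary)
  qed
  then show ?thesis unfolding Inn_def by (intro Collect_cong ex_cong1 rev_conj_cong) simp_all
qed

section \<open>Restriction to centralizers\<close>

lemma Hom_Ab_simps [simp]:
  "\<zero>\<^bsub>Hom_Ab G A H\<^esub> = (\<lambda>x\<in>H. \<zero>\<^bsub>A\<^esub>)"
  "\<phi> \<oplus>\<^bsub>Hom_Ab G A H\<^esub> \<psi> = (\<lambda>x\<in>H. \<phi> x \<oplus>\<^bsub>A\<^esub> \<psi> x)"
  "c \<odot>\<^bsub>Hom_Ab G A H\<^esub> \<phi> = (\<lambda>x\<in>H. c \<otimes>\<^bsub>A\<^esub> \<phi> x)"
  by (simp_all add: Hom_Ab_def)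

lemma Hom_Ab_carrier:
  "\<phi> \<in> carrier (Hom_Ab G A H) \<longleftrightarrow>
    \<phi> \<in> H \<rightarrow>\<^sub>E carrier A \<and> (\<forall>x\<in>H. \<forall>y\<in>H. \<phi> (x \<otimes>\<^bsub>G\<^esub> y) = \<phi> x \<oplus>\<^bsub>A\<^esub> \<phi> y)"
  by (auto simp: Hom_Ab_def hom_def PiE_def)

lemma Hom_Ab_module:
  assumes "subgroup H G"
  shows "module A (Hom_Ab G A H)"
proof -
  have [simp]: "x \<otimes>\<^bsub>G\<^esub> y \<in> H" if "x \<in> H" "y \<in> H" for x y
    using assms that by (rule subgroup.m_closed)
  have "pointwise_module A H (\<lambda>_. regular_module A) (Hom_Ab G A H)"
    by (intro pointwise_module.intro pointwise_module_axioms.intro)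
      (auto simp: A.is_cring module_regular_module Hom_Ab_carrier PiE_iff extensional_def A.a_ac A.r_distr)
  then show ?thesis by (rule pointwise_module.is_module)
qed

lemma subgroup_centralizer:
  assumes w: "w \<in> carrier G"
  shows "subgroup (centralizer G w) G"
proof
  show "x \<otimes>\<^bsub>G\<^esub> y \<in> centralizer G w" if "x \<in> centralizer G w" "y \<in> centralizer G w" for x y
  proof -
    have x: "x \<in> carrier G" "x \<otimes>\<^bsub>G\<^esub> w = w \<otimes>\<^bsub>G\<^esub> x" and y: "y \<in> carrier G" "y \<otimes>\<^bsub>G\<^esub> w = w \<otimes>\<^bsub>G\<^esub> y"
      using that by (auto simp: centralizer_def)
    have "x \<otimes>\<^bsub>G\<^esub> y \<otimes>\<^bsub>G\<^esub> w = x \<otimes>\<^bsub>G\<^esub> w \<otimes>\<^bsub>G\<^esub> y"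
      using x y w by (metis G.m_assoc)
    then show ?thesis using x y w by (simp add: centralizer_def G.m_assoc)
  qed
  show "inv\<^bsub>G\<^esub> x \<in> centralizer G w" if "x \<in> centralizer G w" for x
  proof -
    have x: "x \<in> carrier G" "x \<otimes>\<^bsub>G\<^esub> w = w \<otimes>\<^bsub>G\<^esub> x" using that by (auto simp: centralizer_def)
    have "inv\<^bsub>G\<^esub> x \<otimes>\<^bsub>G\<^esub> (x \<otimes>\<^bsub>G\<^esub> w) \<otimes>\<^bsub>G\<^esub> inv\<^bsub>G\<^esub> x = inv\<^bsub>G\<^esub> x \<otimes>\<^bsub>G\<^esub> (w \<otimes>\<^bsub>G\<^esub> x) \<otimes>\<^bsub>G\<^esub> inv\<^bsub>G\<^esub> x"
      using x by simp
    then show ?thesis using x(1) w by (simp add: centralizer_def G.m_assoc)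
  qed
qed (use w in \<open>auto simp: centralizer_def\<close>)

text \<open>The first two equations say that \<open>(z, w * z)\<close> is a loop at
  \<open>w\<close>; the third is the shift in the second term of the cocycle equation. Bracketing is
  to the right where simplification leaves it so.\<close>

lemma centralizer_conj:
  assumes "z \<in> centralizer G w" "w \<in> carrier G"
  shows "inv\<^bsub>G\<^esub> z \<otimes>\<^bsub>G\<^esub> (w \<otimes>\<^bsub>G\<^esub> z) = w" and "w \<otimes>\<^bsub>G\<^esub> z \<otimes>\<^bsub>G\<^esub> inv\<^bsub>G\<^esub> z = w"
    and "y \<in> carrier G \<Longrightarrow> inv\<^bsub>G\<^esub> z \<otimes>\<^bsub>G\<^esub> (w \<otimes>\<^bsub>G\<^esub> (z \<otimes>\<^bsub>G\<^esub> y)) = w \<otimes>\<^bsub>G\<^esub> y"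
proof -
  have z: "z \<in> carrier G" "w \<otimes>\<^bsub>G\<^esub> z = z \<otimes>\<^bsub>G\<^esub> w" using assms by (auto simp: centralizer_def)
  show 1: "inv\<^bsub>G\<^esub> z \<otimes>\<^bsub>G\<^esub> (w \<otimes>\<^bsub>G\<^esub> z) = w" using z assms(2) by simp
  show "w \<otimes>\<^bsub>G\<^esub> z \<otimes>\<^bsub>G\<^esub> inv\<^bsub>G\<^esub> z = w" using z(1) assms(2) by (simp add: G.m_assoc)
  show "inv\<^bsub>G\<^esub> z \<otimes>\<^bsub>G\<^esub> (w \<otimes>\<^bsub>G\<^esub> (z \<otimes>\<^bsub>G\<^esub> y)) = w \<otimes>\<^bsub>G\<^esub> y" if "y \<in> carrier G"
    using 1 z(1) assms(2) that by (metis G.inv_closed G.m_assoc G.m_closed)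
qed

definition centralizer_restriction :: "'g \<Rightarrow> (('g \<Rightarrow> 'a) \<Rightarrow> 'g \<Rightarrow> 'a) \<Rightarrow> 'g \<Rightarrow> 'a" where
  "centralizer_restriction w d = (\<lambda>z\<in>centralizer G w. d (\<delta> z) (w \<otimes>\<^bsub>G\<^esub> z))"

lemma centralizer_restriction_hom:
  assumes w: "w \<in> carrier G"
  shows "centralizer_restriction w \<in> module_hom A (Der A G) (Hom_Ab G A (centralizer G w))"
proof -
  interpret Z: subgroup "centralizer G w" G using w by (rule subgroup_centralizer)
  have "centralizer_restriction w d \<in> carrier (Hom_Ab G A (centralizer G w))"
    if d: "d \<in> carrier (Der A G)" for d
  proof -
    have "d (\<delta> (x \<otimes>\<^bsub>G\<^esub> y)) (w \<otimes>\<^bsub>G\<^esub> (x \<otimes>\<^bsub>G\<^esub> y)) = d (\<delta> x) (w \<otimes>\<^bsub>G\<^esub> x) \<oplus>\<^bsub>A\<^esub> d (\<delta> y) (w \<otimes>\<^bsub>G\<^esub> y)"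
      if x: "x \<in> centralizer G w" and y: "y \<in> centralizer G w" for x y
    proof -
      have "x \<in> carrier G" "y \<in> carrier G" using x y by auto
      \<comment> \<open>The cocycle equation at \<open>u = w * x * y\<close>: in its first term
        \<open>u * y^-1 = w * x\<close>, and in its second \<open>x^-1 * u = w * y\<close> because
        \<open>x\<close> centralizes \<open>w\<close>.\<close>
      then show ?thesis
        using cocycle_mult[OF cocycle_coefficient[OF d], of x y "w \<otimes>\<^bsub>G\<^esub> (x \<otimes>\<^bsub>G\<^esub> y)"] w
          centralizer_conj(3)[OF x w] by (simp add: G.m_assoc)
    qed
    then show ?thesis
      using d w by (auto simp: Hom_Ab_carrier centralizer_restriction_def coefficient_mem)
  qed
  moreover have "centralizer_restriction w (d \<oplus>\<^bsub>Der A G\<^esub> d') =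
      centralizer_restriction w d \<oplus>\<^bsub>Hom_Ab G A (centralizer G w)\<^esub> centralizer_restriction w d'"
    if "d \<in> carrier (Der A G)" "d' \<in> carrier (Der A G)" for d d'
    unfolding centralizer_restriction_def Hom_Ab_simps
    by (rule restrict_ext) (use that w in \<open>simp add: module_hom_add[OF coefficient_module_hom]\<close>)
  moreover have "centralizer_restriction w (c \<odot>\<^bsub>Der A G\<^esub> d) =
      c \<odot>\<^bsub>Hom_Ab G A (centralizer G w)\<^esub> centralizer_restriction w d"
    if "c \<in> carrier A" "d \<in> carrier (Der A G)" for c d
    unfolding centralizer_restriction_def Hom_Ab_simps
    by (rule restrict_ext) (use that w in \<open>simp add: module_hom_smult[OF coefficient_module_hom]\<close>)
  ultimately show ?thesis by (auto simp: module_hom_def simp del: Hom_Ab_simps)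
qed

text \<open>Two arrows from \<open>w\<close> with the same target differ by a loop at
  \<open>w\<close>. Every change of conjugator below goes through this fact.\<close>

lemma conj_eq_imp_centralizer:
  assumes "w \<in> carrier G" "g \<in> carrier G" "h \<in> carrier G"
    and eq: "inv\<^bsub>G\<^esub> g \<otimes>\<^bsub>G\<^esub> w \<otimes>\<^bsub>G\<^esub> g = inv\<^bsub>G\<^esub> h \<otimes>\<^bsub>G\<^esub> w \<otimes>\<^bsub>G\<^esub> h"
  shows "h \<otimes>\<^bsub>G\<^esub> inv\<^bsub>G\<^esub> g \<in> centralizer G w"
proof -
  have "h \<otimes>\<^bsub>G\<^esub> (inv\<^bsub>G\<^esub> g \<otimes>\<^bsub>G\<^esub> w \<otimes>\<^bsub>G\<^esub> g) \<otimes>\<^bsub>G\<^esub> inv\<^bsub>G\<^esub> g = h \<otimes>\<^bsub>G\<^esub> (inv\<^bsub>G\<^esub> h \<otimes>\<^bsub>G\<^esub> w \<otimes>\<^bsub>G\<^esub> h) \<otimes>\<^bsub>G\<^esub> inv\<^bsub>G\<^esub> g"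
    using eq by simp
  then show ?thesis using assms(1-3) by (simp add: centralizer_def G.m_assoc)
qed

section \<open>Inner derivations as the common kernel of the restrictions\<close>

lemma Inn_subset_Der: "Inn A G \<subseteq> carrier (Der A G)"
  by (auto simp: Inn_eq derivation_of_mem cocycle_coboundary)

text \<open>A loop has equal source and target, so a potential difference vanishes on it.\<close>

lemma centralizer_restriction_Inn:
  assumes d: "d \<in> Inn A G" and w: "w \<in> carrier G"
  shows "centralizer_restriction w d = \<zero>\<^bsub>Hom_Ab G A (centralizer G w)\<^esub>"
proof -
  obtain C where C: "C \<in> carrier G \<rightarrow> carrier A" and d: "d = derivation_of (coboundary C)"
    using d by (auto simp: Inn_eq)
  have "d (\<delta> z) (w \<otimes>\<^bsub>G\<^esub> z) = \<zero>\<^bsub>A\<^esub>" if z: "z \<in> centralizer G w" for z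
  proof -
    have "z \<in> carrier G" using z by (simp add: centralizer_def)
    then have "d (\<delta> z) (w \<otimes>\<^bsub>G\<^esub> z) = C w \<ominus>\<^bsub>A\<^esub> C w"
      using w C by (simp add: d derivation_of_basis cocycle_coboundary coboundary_def centralizer_conj[OF z w])
    then show ?thesis using funcset_mem[OF C w] by (simp add: A.minus_eq A.r_neg)
  qed
  then show ?thesis by (auto simp: centralizer_restriction_def fun_eq_iff)
qed

text \<open>Both values belong to arrows from \<open>w\<close> to the same target. The second arrow
  is the first preceded by a loop at \<open>w\<close>, on which \<open>c\<close> vanishes. This is
  what makes the potential in \<open>Inn_eq_kernel\<close> well defined.\<close>

lemma cocycle_eq_of_conj_eq:
  assumes c: "cocycle c" and w: "w \<in> carrier G" and g: "g \<in> carrier G" and h: "h \<in> carrier G"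
    and zero: "\<And>z. z \<in> centralizer G w \<Longrightarrow> c z (w \<otimes>\<^bsub>G\<^esub> z) = \<zero>\<^bsub>A\<^esub>"
    and eq: "inv\<^bsub>G\<^esub> g \<otimes>\<^bsub>G\<^esub> w \<otimes>\<^bsub>G\<^esub> g = inv\<^bsub>G\<^esub> h \<otimes>\<^bsub>G\<^esub> w \<otimes>\<^bsub>G\<^esub> h"
  shows "c g (w \<otimes>\<^bsub>G\<^esub> g) = c h (w \<otimes>\<^bsub>G\<^esub> h)"
proof -
  define z where "z = h \<otimes>\<^bsub>G\<^esub> inv\<^bsub>G\<^esub> g"
  have z: "z \<in> centralizer G w" unfolding z_def using conj_eq_imp_centralizer[OF w g h eq] .
  then have zG: "z \<in> carrier G" by (simp add: centralizer_def)
  have h_eq: "h = z \<otimes>\<^bsub>G\<^esub> g" using g h by (simp add: z_def G.m_assoc)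
  have "c h (w \<otimes>\<^bsub>G\<^esub> h) = c z (w \<otimes>\<^bsub>G\<^esub> z) \<oplus>\<^bsub>A\<^esub> c g (w \<otimes>\<^bsub>G\<^esub> g)"
    using cocycle_mult[OF c zG g, of "w \<otimes>\<^bsub>G\<^esub> h"] w g zG centralizer_conj(3)[OF z w g]
    by (simp add: h_eq G.m_assoc)
  then show ?thesis using zero[OF z] cocycle_mem[OF c g, of "w \<otimes>\<^bsub>G\<^esub> g"] w g by simp
qed

text \<open>The connected components of the groupoid are the conjugacy classes, so a potential can
  be integrated in each class outward from its one representative. Vanishing on the loops there
  makes the integral independent of the path.\<close>

lemma Inn_eq_kernel:
  assumes u: "conj_class_reps G n u"
  shows "Inn A G = {d \<in> carrier (Der A G). \<forall>i\<in>{1..n}.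
    centralizer_restriction (u i) d = \<zero>\<^bsub>Hom_Ab G A (centralizer G (u i))\<^esub>}"
proof -
  have uG: "u i \<in> carrier G" if "i \<in> {1..n}" for i using u that by (simp add: conj_class_reps_def)
  have "d \<in> Inn A G"
    if d: "d \<in> carrier (Der A G)" and ker: "\<And>i. i \<in> {1..n} \<Longrightarrow>
      centralizer_restriction (u i) d = \<zero>\<^bsub>Hom_Ab G A (centralizer G (u i))\<^esub>" for d
  proof -
    define c where "c = (\<lambda>v. d (\<delta> v))"
    have c: "cocycle c" unfolding c_def by (rule cocycle_coefficient[OF d])
    have zero: "c z (u i \<otimes>\<^bsub>G\<^esub> z) = \<zero>\<^bsub>A\<^esub>" if "i \<in> {1..n}" "z \<in> centralizer G (u i)" for i z
      using fun_cong[OF ker[OF that(1)], of z] that(2) by (simp add: centralizer_restriction_def c_def)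
    \<comment> \<open>Index and conjugator are chosen together as a pair. The index is forced, since
      exactly one representative is conjugate to \<open>x\<close>; the conjugator is arbitrary. The
      minus sign in \<open>C\<close> compensates for \<open>coboundary\<close> being source minus
      target.\<close>
    let ?P = "\<lambda>x (i, g). i \<in> {1..n} \<and> g \<in> carrier G \<and> x = inv\<^bsub>G\<^esub> g \<otimes>\<^bsub>G\<^esub> u i \<otimes>\<^bsub>G\<^esub> g"
    define C where "C x = (case SOME p. ?P x p of (i, g) \<Rightarrow> \<ominus>\<^bsub>A\<^esub> c g (u i \<otimes>\<^bsub>G\<^esub> g))" for x
    have C: "C (inv\<^bsub>G\<^esub> g \<otimes>\<^bsub>G\<^esub> u i \<otimes>\<^bsub>G\<^esub> g) = \<ominus>\<^bsub>A\<^esub> c g (u i \<otimes>\<^bsub>G\<^esub> g)"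
      if i: "i \<in> {1..n}" and g: "g \<in> carrier G" for i g
    proof -
      let ?x = "inv\<^bsub>G\<^esub> g \<otimes>\<^bsub>G\<^esub> u i \<otimes>\<^bsub>G\<^esub> g"
      obtain j h where jh: "(SOME p. ?P ?x p) = (j, h)" by fastforce
      have "?P ?x (SOME p. ?P ?x p)" by (rule someI[of _ "(i, g)"]) (use i g in simp)
      then have j: "j \<in> {1..n}" and h: "h \<in> carrier G" and eq: "?x = inv\<^bsub>G\<^esub> h \<otimes>\<^bsub>G\<^esub> u j \<otimes>\<^bsub>G\<^esub> h"
        unfolding jh by auto
      have "?x \<in> carrier G" using g uG[OF i] by simp
      then have "\<exists>!i. i \<in> {1..n} \<and> conjugate G (u i) ?x" using u unfolding conj_class_reps_def by blast
      moreover have "conjugate G (u i) ?x" "conjugate G (u j) ?x"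
        using g h eq unfolding conjugate_def by blast+
      ultimately have "j = i" using i j by auto
      then have "c g (u i \<otimes>\<^bsub>G\<^esub> g) = c h (u j \<otimes>\<^bsub>G\<^esub> h)"
        using cocycle_eq_of_conj_eq[OF c uG[OF i] g h zero[OF i]] eq by simp
      then show ?thesis unfolding C_def jh by simp
    qed
    have reps: "\<exists>i g. i \<in> {1..n} \<and> g \<in> carrier G \<and> x = inv\<^bsub>G\<^esub> g \<otimes>\<^bsub>G\<^esub> u i \<otimes>\<^bsub>G\<^esub> g"
      if "x \<in> carrier G" for x
      using u that unfolding conj_class_reps_def conjugate_def by blast
    have C_mem: "C \<in> carrier G \<rightarrow> carrier A"
    proof
      fix x assume "x \<in> carrier G"
      then obtain i g where ig: "i \<in> {1..n}" "g \<in> carrier G" "x = inv\<^bsub>G\<^esub> g \<otimes>\<^bsub>G\<^esub> u i \<otimes>\<^bsub>G\<^esub> g"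
        using reps by blast
      then show "C x \<in> carrier A" using C[OF ig(1,2)] uG by (simp add: cocycle_mem[OF c])
    qed
    have "d = derivation_of (coboundary C)"
    proof (rule Der_eqI[OF d derivation_of_mem[OF cocycle_coboundary[OF C_mem]]])
      fix v y assume v: "v \<in> carrier G" and y: "y \<in> carrier G"
      define x where "x = y \<otimes>\<^bsub>G\<^esub> inv\<^bsub>G\<^esub> v"
      have x: "x \<in> carrier G" using v y by (simp add: x_def)
      have y_eq: "y = x \<otimes>\<^bsub>G\<^esub> v" using v y by (simp add: x_def G.m_assoc)
      obtain i g where i: "i \<in> {1..n}" and g: "g \<in> carrier G" and
        xg: "x = inv\<^bsub>G\<^esub> g \<otimes>\<^bsub>G\<^esub> u i \<otimes>\<^bsub>G\<^esub> g" using reps[OF x] by blast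
      note [simp] = uG[OF i] v g cocycle_mem[OF c]
      have "C x = \<ominus>\<^bsub>A\<^esub> c g (u i \<otimes>\<^bsub>G\<^esub> g)" unfolding xg by (rule C[OF i g])
      \<comment> \<open>If \<open>g\<close> conjugates \<open>u i\<close> to the source
        \<open>x\<close> of the arrow \<open>(v, y)\<close>, then \<open>g * v\<close> conjugates it
        to the target \<open>v^-1 * y\<close>. The arrow of \<open>g * v\<close> is the arrow of
        \<open>g\<close> followed by \<open>(v, y)\<close>, so additivity leaves exactly
        \<open>c v y\<close> as the potential difference.\<close>
      moreover have "C (inv\<^bsub>G\<^esub> v \<otimes>\<^bsub>G\<^esub> y) = \<ominus>\<^bsub>A\<^esub> c (g \<otimes>\<^bsub>G\<^esub> v) (u i \<otimes>\<^bsub>G\<^esub> (g \<otimes>\<^bsub>G\<^esub> v))"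
        using C[OF i, of "g \<otimes>\<^bsub>G\<^esub> v"] by (simp add: y_eq xg G.inv_mult_group G.m_assoc)
      moreover have "c (g \<otimes>\<^bsub>G\<^esub> v) (u i \<otimes>\<^bsub>G\<^esub> (g \<otimes>\<^bsub>G\<^esub> v)) = c g (u i \<otimes>\<^bsub>G\<^esub> g) \<oplus>\<^bsub>A\<^esub> c v y"
        using cocycle_mult[OF c g v, of "u i \<otimes>\<^bsub>G\<^esub> (g \<otimes>\<^bsub>G\<^esub> v)"] by (simp add: y_eq xg G.m_assoc)
      ultimately have "coboundary C v y = c v y"
        using y by (simp add: coboundary_def A.minus_eq A.r_neg1 flip: x_def)
      then show "d (\<delta> v) y = derivation_of (coboundary C) (\<delta> v) y"
        using v y C_mem by (simp add: derivation_of_basis cocycle_coboundary c_def)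
    qed
    then show ?thesis using C_mem by (auto simp: Inn_eq)
  qed
  then show ?thesis
    using Inn_subset_Der centralizer_restriction_Inn uG by blast
qed

section \<open>Restrictions and existence of \<open>D(\<phi>)\<close>\<close>

text \<open>Restrictions read off coefficients at loops only, and there \<open>D_spec\<close> leaves
  no freedom: a loop at \<open>w\<close> falls under its first clause, a loop at an element not
  conjugate to \<open>w\<close> under its second. Hence every admissible \<open>d\<close> has the
  same restrictions.\<close>

lemma
  assumes w: "w \<in> carrier G" and \<phi>: "\<phi> \<in> carrier (Hom_Ab G A (centralizer G w))"
    and D: "D_spec A G w \<phi> d"
  shows centralizer_restriction_same: "centralizer_restriction w d = \<phi>"
    and centralizer_restriction_other: "w' \<in> carrier G \<Longrightarrow> \<not> conjugate G w w' \<Longrightarrow>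
      centralizer_restriction w' d = \<zero>\<^bsub>Hom_Ab G A (centralizer G w')\<^esub>"
proof -
  have "d (\<delta> z) (w \<otimes>\<^bsub>G\<^esub> z) = \<phi> z" if z: "z \<in> centralizer G w" for z
  proof -
    have zG: "z \<in> carrier G" using z by (simp add: centralizer_def)
    have "\<forall>g\<in>carrier G. inv\<^bsub>G\<^esub> z \<otimes>\<^bsub>G\<^esub> (w \<otimes>\<^bsub>G\<^esub> z) = w \<otimes>\<^bsub>G\<^esub> z \<otimes>\<^bsub>G\<^esub> inv\<^bsub>G\<^esub> z \<and>
        w \<otimes>\<^bsub>G\<^esub> z \<otimes>\<^bsub>G\<^esub> inv\<^bsub>G\<^esub> z = inv\<^bsub>G\<^esub> g \<otimes>\<^bsub>G\<^esub> w \<otimes>\<^bsub>G\<^esub> g \<longrightarrow>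
        d (\<delta> z) (w \<otimes>\<^bsub>G\<^esub> z) = \<phi> (g \<otimes>\<^bsub>G\<^esub> z \<otimes>\<^bsub>G\<^esub> inv\<^bsub>G\<^esub> g)"
      using D zG w unfolding D_spec_def by blast
    \<comment> \<open>The conjugator is the identity, as the loop is based at \<open>w\<close>
      itself.\<close>
    from bspec[OF this G.one_closed] show ?thesis
      using centralizer_conj[OF z w] zG w by simp
  qed
  then show "centralizer_restriction w d = \<phi>"
    using \<phi> by (auto simp: centralizer_restriction_def fun_eq_iff Hom_Ab_carrier PiE_iff extensional_def)
  show "centralizer_restriction w' d = \<zero>\<^bsub>Hom_Ab G A (centralizer G w')\<^esub>"
    if w': "w' \<in> carrier G" "\<not> conjugate G w w'"
  proof -
    have "d (\<delta> z) (w' \<otimes>\<^bsub>G\<^esub> z) = \<zero>\<^bsub>A\<^esub>" if z: "z \<in> centralizer G w'" for z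
    proof -
      have zG: "z \<in> carrier G" using z by (simp add: centralizer_def)
      then have "\<not> conjugate G w (inv\<^bsub>G\<^esub> z \<otimes>\<^bsub>G\<^esub> (w' \<otimes>\<^bsub>G\<^esub> z))"
        using centralizer_conj[OF z w'(1)] w'(2) by simp
      then show ?thesis using D zG w'(1) unfolding D_spec_def by (meson G.m_closed)
    qed
    then show ?thesis by (auto simp: centralizer_restriction_def fun_eq_iff)
  qed
qed

text \<open>The chosen conjugators carry all arrows within the class of \<open>w\<close> to loops at
  \<open>w\<close>, compatibly with composition. Applying \<open>\<phi>\<close> and extending by
  zero to the other classes gives a cocycle.\<close>

lemma D_spec_exists:
  assumes w: "w \<in> carrier G" and \<phi>: "\<phi> \<in> carrier (Hom_Ab G A (centralizer G w))"
  shows "\<exists>d. D_spec A G w \<phi> d"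
proof -
  have \<phi>_mem: "\<phi> z \<in> carrier A" if "z \<in> centralizer G w" for z
    using \<phi> that by (auto simp: Hom_Ab_carrier)
  have \<phi>_mult: "\<phi> (x \<otimes>\<^bsub>G\<^esub> y) = \<phi> x \<oplus>\<^bsub>A\<^esub> \<phi> y"
    if "x \<in> centralizer G w" "y \<in> centralizer G w" for x y
    using \<phi> that by (auto simp: Hom_Ab_carrier)
  \<comment> \<open>An arbitrary conjugator, meaningful only for conjugates of \<open>w\<close>;
    every later use is guarded by \<open>conjugate\<close>.\<close>
  define t where "t x = (SOME g. g \<in> carrier G \<and> x = inv\<^bsub>G\<^esub> g \<otimes>\<^bsub>G\<^esub> w \<otimes>\<^bsub>G\<^esub> g)" for x
  have t: "t x \<in> carrier G" "inv\<^bsub>G\<^esub> (t x) \<otimes>\<^bsub>G\<^esub> w \<otimes>\<^bsub>G\<^esub> t x = x" if "conjugate G w x" for x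
  proof -
    have "\<exists>g. g \<in> carrier G \<and> x = inv\<^bsub>G\<^esub> g \<otimes>\<^bsub>G\<^esub> w \<otimes>\<^bsub>G\<^esub> g"
      using that by (auto simp: conjugate_def)
    from someI_ex[OF this, folded t_def]
    show "t x \<in> carrier G" "inv\<^bsub>G\<^esub> (t x) \<otimes>\<^bsub>G\<^esub> w \<otimes>\<^bsub>G\<^esub> t x = x" by simp_all
  qed
  \<comment> \<open>Source and target of an arrow are conjugate through \<open>v\<close>. This
    reconciles the test on the source in the cocycle defined below with the test on the target in
    \<open>D_spec\<close>.\<close>
  have conj_shift: "conjugate G w (inv\<^bsub>G\<^esub> v \<otimes>\<^bsub>G\<^esub> u) \<longleftrightarrow> conjugate G w (u \<otimes>\<^bsub>G\<^esub> inv\<^bsub>G\<^esub> v)"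
    if v: "v \<in> carrier G" and u: "u \<in> carrier G" for v u
  proof
    assume "conjugate G w (inv\<^bsub>G\<^esub> v \<otimes>\<^bsub>G\<^esub> u)"
    then obtain g where g: "g \<in> carrier G" "inv\<^bsub>G\<^esub> v \<otimes>\<^bsub>G\<^esub> u = inv\<^bsub>G\<^esub> g \<otimes>\<^bsub>G\<^esub> w \<otimes>\<^bsub>G\<^esub> g"
      by (auto simp: conjugate_def)
    have "u \<otimes>\<^bsub>G\<^esub> inv\<^bsub>G\<^esub> v = v \<otimes>\<^bsub>G\<^esub> (inv\<^bsub>G\<^esub> v \<otimes>\<^bsub>G\<^esub> u) \<otimes>\<^bsub>G\<^esub> inv\<^bsub>G\<^esub> v"
      using u v by simp
    also have "\<dots> = inv\<^bsub>G\<^esub> (g \<otimes>\<^bsub>G\<^esub> inv\<^bsub>G\<^esub> v) \<otimes>\<^bsub>G\<^esub> w \<otimes>\<^bsub>G\<^esub> (g \<otimes>\<^bsub>G\<^esub> inv\<^bsub>G\<^esub> v)"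
      unfolding g(2) using g(1) v w by (simp add: G.inv_mult_group G.m_assoc)
    finally show "conjugate G w (u \<otimes>\<^bsub>G\<^esub> inv\<^bsub>G\<^esub> v)"
      using g(1) v unfolding conjugate_def by (intro bexI[of _ "g \<otimes>\<^bsub>G\<^esub> inv\<^bsub>G\<^esub> v"]) auto
  next
    assume "conjugate G w (u \<otimes>\<^bsub>G\<^esub> inv\<^bsub>G\<^esub> v)"
    then obtain g where g: "g \<in> carrier G" "u \<otimes>\<^bsub>G\<^esub> inv\<^bsub>G\<^esub> v = inv\<^bsub>G\<^esub> g \<otimes>\<^bsub>G\<^esub> w \<otimes>\<^bsub>G\<^esub> g"
      by (auto simp: conjugate_def)
    have "inv\<^bsub>G\<^esub> v \<otimes>\<^bsub>G\<^esub> u = inv\<^bsub>G\<^esub> v \<otimes>\<^bsub>G\<^esub> (u \<otimes>\<^bsub>G\<^esub> inv\<^bsub>G\<^esub> v) \<otimes>\<^bsub>G\<^esub> v"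
      using u v by (simp add: G.m_assoc)
    also have "\<dots> = inv\<^bsub>G\<^esub> (g \<otimes>\<^bsub>G\<^esub> v) \<otimes>\<^bsub>G\<^esub> w \<otimes>\<^bsub>G\<^esub> (g \<otimes>\<^bsub>G\<^esub> v)"
      unfolding g(2) using g(1) v w by (simp add: G.inv_mult_group G.m_assoc)
    finally show "conjugate G w (inv\<^bsub>G\<^esub> v \<otimes>\<^bsub>G\<^esub> u)"
      using g(1) v unfolding conjugate_def by (intro bexI[of _ "g \<otimes>\<^bsub>G\<^esub> v"]) auto
  qed
  \<comment> \<open>The loop at \<open>w\<close> that goes to the source of \<open>(v, u)\<close> by
    the chosen conjugator, follows \<open>v\<close>, and returns from the target.\<close>
  define \<tau> where "\<tau> v u = t (u \<otimes>\<^bsub>G\<^esub> inv\<^bsub>G\<^esub> v) \<otimes>\<^bsub>G\<^esub> v \<otimes>\<^bsub>G\<^esub> inv\<^bsub>G\<^esub> (t (inv\<^bsub>G\<^esub> v \<otimes>\<^bsub>G\<^esub> u))" for v u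
  have \<tau>_mem: "\<tau> v u \<in> centralizer G w"
    if v: "v \<in> carrier G" and u: "u \<in> carrier G" and conj: "conjugate G w (u \<otimes>\<^bsub>G\<^esub> inv\<^bsub>G\<^esub> v)" for v u
  proof -
    let ?p = "t (u \<otimes>\<^bsub>G\<^esub> inv\<^bsub>G\<^esub> v)" and ?q = "t (inv\<^bsub>G\<^esub> v \<otimes>\<^bsub>G\<^esub> u)"
    note p = t[OF conj] and q = t[OF conj[folded conj_shift[OF v u]]]
    have "inv\<^bsub>G\<^esub> (?p \<otimes>\<^bsub>G\<^esub> v) \<otimes>\<^bsub>G\<^esub> w \<otimes>\<^bsub>G\<^esub> (?p \<otimes>\<^bsub>G\<^esub> v) = inv\<^bsub>G\<^esub> v \<otimes>\<^bsub>G\<^esub> (inv\<^bsub>G\<^esub> ?p \<otimes>\<^bsub>G\<^esub> w \<otimes>\<^bsub>G\<^esub> ?p) \<otimes>\<^bsub>G\<^esub> v"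
      using p(1) v w by (simp add: G.inv_mult_group G.m_assoc)
    also have "\<dots> = inv\<^bsub>G\<^esub> v \<otimes>\<^bsub>G\<^esub> u"
      unfolding p(2) using u v by (simp add: G.m_assoc)
    also have "\<dots> = inv\<^bsub>G\<^esub> ?q \<otimes>\<^bsub>G\<^esub> w \<otimes>\<^bsub>G\<^esub> ?q" using q(2) by simp
    finally show ?thesis
      unfolding \<tau>_def using p(1) q(1) v w by (intro conj_eq_imp_centralizer) auto
  qed
  define c where "c v u = (if conjugate G w (u \<otimes>\<^bsub>G\<^esub> inv\<^bsub>G\<^esub> v) then \<phi> (\<tau> v u) else \<zero>\<^bsub>A\<^esub>)" for v u
  have c: "cocycle c"
    unfolding cocycle_def
  proof (intro conjI ballI)
    fix h k u assume h: "h \<in> carrier G" and k: "k \<in> carrier G" and u: "u \<in> carrier G"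
    let ?x = "u \<otimes>\<^bsub>G\<^esub> inv\<^bsub>G\<^esub> (h \<otimes>\<^bsub>G\<^esub> k)" and ?y = "inv\<^bsub>G\<^esub> h \<otimes>\<^bsub>G\<^esub> u \<otimes>\<^bsub>G\<^esub> inv\<^bsub>G\<^esub> k"
    have x: "u \<otimes>\<^bsub>G\<^esub> inv\<^bsub>G\<^esub> k \<otimes>\<^bsub>G\<^esub> inv\<^bsub>G\<^esub> h = ?x"
      and y: "inv\<^bsub>G\<^esub> h \<otimes>\<^bsub>G\<^esub> (u \<otimes>\<^bsub>G\<^esub> inv\<^bsub>G\<^esub> k) = ?y"
      and z: "inv\<^bsub>G\<^esub> k \<otimes>\<^bsub>G\<^esub> (inv\<^bsub>G\<^esub> h \<otimes>\<^bsub>G\<^esub> u) = inv\<^bsub>G\<^esub> (h \<otimes>\<^bsub>G\<^esub> k) \<otimes>\<^bsub>G\<^esub> u"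
      using h k u by (simp_all add: G.inv_mult_group G.m_assoc)
    have xy: "conjugate G w ?x \<longleftrightarrow> conjugate G w ?y"
      using conj_shift[of h "u \<otimes>\<^bsub>G\<^esub> inv\<^bsub>G\<^esub> k"] h k u by (simp add: x y)
    show "c (h \<otimes>\<^bsub>G\<^esub> k) u = c h (u \<otimes>\<^bsub>G\<^esub> inv\<^bsub>G\<^esub> k) \<oplus>\<^bsub>A\<^esub> c k (inv\<^bsub>G\<^esub> h \<otimes>\<^bsub>G\<^esub> u)"
    proof (cases "conjugate G w ?x")
      case True
      then have y': "conjugate G w ?y" and z': "conjugate G w (inv\<^bsub>G\<^esub> (h \<otimes>\<^bsub>G\<^esub> k) \<otimes>\<^bsub>G\<^esub> u)"
        using xy conj_shift[of "h \<otimes>\<^bsub>G\<^esub> k" u] h k u by simp_all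
      \<comment> \<open>The return from the intermediate object cancels against the departure to it,
        since both use the same chosen conjugator.\<close>
      have "\<tau> (h \<otimes>\<^bsub>G\<^esub> k) u = \<tau> h (u \<otimes>\<^bsub>G\<^esub> inv\<^bsub>G\<^esub> k) \<otimes>\<^bsub>G\<^esub> \<tau> k (inv\<^bsub>G\<^esub> h \<otimes>\<^bsub>G\<^esub> u)"
        unfolding \<tau>_def x y z using h k t(1)[OF True] t(1)[OF y'] t(1)[OF z'] by (simp add: G.m_assoc)
      moreover have "\<tau> h (u \<otimes>\<^bsub>G\<^esub> inv\<^bsub>G\<^esub> k) \<in> centralizer G w"
        using h k u True by (intro \<tau>_mem) (simp_all add: x)
      moreover have "\<tau> k (inv\<^bsub>G\<^esub> h \<otimes>\<^bsub>G\<^esub> u) \<in> centralizer G w"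
        using h k u y' by (intro \<tau>_mem) simp_all
      ultimately show ?thesis
        using True y' by (simp add: c_def x \<phi>_mult)
    next
      case False
      \<comment> \<open>None of the three arrows lies in the class of \<open>w\<close>, and the
        equation reads 0 = 0 + 0.\<close>
      then show ?thesis using xy by (simp add: c_def x)
    qed
  qed (auto simp: c_def \<phi>_mem \<tau>_mem)
  have "D_spec A G w \<phi> (derivation_of c)"
    unfolding D_spec_def
  proof (intro conjI ballI impI)
    show "derivation_of c \<in> carrier (Der A G)" by (rule derivation_of_mem[OF c])
    fix u v assume u: "u \<in> carrier G" and v: "v \<in> carrier G"
    show "derivation_of c (\<delta> v) u = \<zero>\<^bsub>A\<^esub>" if "\<not> conjugate G w (inv\<^bsub>G\<^esub> v \<otimes>\<^bsub>G\<^esub> u)"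
      using that u v conj_shift by (simp add: derivation_of_basis[OF c] c_def)
    fix g assume g: "g \<in> carrier G"
      and eq: "inv\<^bsub>G\<^esub> v \<otimes>\<^bsub>G\<^esub> u = u \<otimes>\<^bsub>G\<^esub> inv\<^bsub>G\<^esub> v \<and> u \<otimes>\<^bsub>G\<^esub> inv\<^bsub>G\<^esub> v = inv\<^bsub>G\<^esub> g \<otimes>\<^bsub>G\<^esub> w \<otimes>\<^bsub>G\<^esub> g"
    let ?x = "u \<otimes>\<^bsub>G\<^esub> inv\<^bsub>G\<^esub> v"
    have conj: "conjugate G w ?x" using g eq by (auto simp: conjugate_def)
    note p = t[OF conj]
    \<comment> \<open>The given conjugator \<open>g\<close> and the chosen one differ by this
      element of the centralizer.\<close>
    define z where "z = g \<otimes>\<^bsub>G\<^esub> inv\<^bsub>G\<^esub> (t ?x)"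
    have z: "z \<in> centralizer G w"
      unfolding z_def using p g eq w by (intro conj_eq_imp_centralizer) auto
    have \<tau>: "\<tau> v u = t ?x \<otimes>\<^bsub>G\<^esub> v \<otimes>\<^bsub>G\<^esub> inv\<^bsub>G\<^esub> (t ?x)" using eq by (simp add: \<tau>_def)
    have \<tau>': "\<tau> v u \<in> centralizer G w" using \<tau>_mem[OF v u conj] .
    have gv: "g \<otimes>\<^bsub>G\<^esub> v \<otimes>\<^bsub>G\<^esub> inv\<^bsub>G\<^esub> g \<in> centralizer G w"
    proof (rule conj_eq_imp_centralizer[OF w g])
      show "g \<otimes>\<^bsub>G\<^esub> v \<in> carrier G" using g v by simp
      have "inv\<^bsub>G\<^esub> (g \<otimes>\<^bsub>G\<^esub> v) \<otimes>\<^bsub>G\<^esub> w \<otimes>\<^bsub>G\<^esub> (g \<otimes>\<^bsub>G\<^esub> v) = inv\<^bsub>G\<^esub> v \<otimes>\<^bsub>G\<^esub> (inv\<^bsub>G\<^esub> g \<otimes>\<^bsub>G\<^esub> w \<otimes>\<^bsub>G\<^esub> g) \<otimes>\<^bsub>G\<^esub> v"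
        using g v w by (simp add: G.inv_mult_group G.m_assoc)
      also have "\<dots> = inv\<^bsub>G\<^esub> v \<otimes>\<^bsub>G\<^esub> ?x \<otimes>\<^bsub>G\<^esub> v" using eq by simp
      also have "\<dots> = inv\<^bsub>G\<^esub> v \<otimes>\<^bsub>G\<^esub> u" using u v by (simp add: G.m_assoc)
      finally show "inv\<^bsub>G\<^esub> g \<otimes>\<^bsub>G\<^esub> w \<otimes>\<^bsub>G\<^esub> g = inv\<^bsub>G\<^esub> (g \<otimes>\<^bsub>G\<^esub> v) \<otimes>\<^bsub>G\<^esub> w \<otimes>\<^bsub>G\<^esub> (g \<otimes>\<^bsub>G\<^esub> v)"
        using eq by simp
    qed
    \<comment> \<open>The loop transported by \<open>g\<close> is
      \<open>z * \<tau> v u * z^-1\<close>. To avoid the inverse, \<open>z\<close> is moved to the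
      other side; \<open>\<phi> z\<close> then cancels because addition in \<open>A\<close> is
      commutative.\<close>
    have "\<phi> (g \<otimes>\<^bsub>G\<^esub> v \<otimes>\<^bsub>G\<^esub> inv\<^bsub>G\<^esub> g) \<oplus>\<^bsub>A\<^esub> \<phi> z = \<phi> (g \<otimes>\<^bsub>G\<^esub> v \<otimes>\<^bsub>G\<^esub> inv\<^bsub>G\<^esub> g \<otimes>\<^bsub>G\<^esub> z)"
      using \<phi>_mult[OF gv z] by simp
    also have "g \<otimes>\<^bsub>G\<^esub> v \<otimes>\<^bsub>G\<^esub> inv\<^bsub>G\<^esub> g \<otimes>\<^bsub>G\<^esub> z = z \<otimes>\<^bsub>G\<^esub> \<tau> v u"
      using g v p(1) by (simp add: \<tau> z_def G.m_assoc)
    also have "\<phi> (z \<otimes>\<^bsub>G\<^esub> \<tau> v u) = \<phi> (\<tau> v u) \<oplus>\<^bsub>A\<^esub> \<phi> z"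
      using \<phi>_mult[OF z \<tau>'] \<phi>_mem[OF z] \<phi>_mem[OF \<tau>'] by (simp add: A.a_comm)
    finally have "\<phi> (g \<otimes>\<^bsub>G\<^esub> v \<otimes>\<^bsub>G\<^esub> inv\<^bsub>G\<^esub> g) = \<phi> (\<tau> v u)"
      using \<phi>_mem[OF z] \<phi>_mem[OF \<tau>'] \<phi>_mem[OF gv] by simp
    then show "derivation_of c (\<delta> v) u = \<phi> (g \<otimes>\<^bsub>G\<^esub> v \<otimes>\<^bsub>G\<^esub> inv\<^bsub>G\<^esub> g)"
      using u v conj by (simp add: derivation_of_basis[OF c] c_def)
  qed
  then show ?thesis by blast
qed

end

text \<open>The first conjunct provides admissible derivations, so that the second, which covers
  every admissible choice of \<open>D\<close>, speaks about an inhabited family of choices.\<close>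

theorem theorem5p1:
  fixes G :: "('g, 'h) monoid_scheme" and A :: "('a, 'k) ring_scheme"
    and n :: nat and u :: "nat \<Rightarrow> 'g"
  assumes "group G" and "finite (carrier G)" and "cring A"
    and "conj_class_reps G n u"
  shows "(\<forall>i\<in>{1..n}. \<forall>\<phi>\<in>carrier (Hom_Ab G A (centralizer G (u i))).
            \<exists>d. D_spec A G (u i) \<phi> d) \<and>
         (\<forall>D. (\<forall>i\<in>{1..n}. \<forall>\<phi>\<in>carrier (Hom_Ab G A (centralizer G (u i))).
                  D_spec A G (u i) \<phi> (D i \<phi>)) \<longrightarrow>
            F_map A G n D \<in> module_iso A
              (direct_sum_module {1..n} (\<lambda>i. Hom_Ab G A (centralizer G (u i))))
              (Out A G))"
proof -
  interpret finite_group_algebra G A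
    using assms by (simp add: finite_group_algebra_def finite_group_algebra_axioms_def)
  have uG: "u i \<in> carrier G" if "i \<in> {1..n}" for i
    using assms(4) that by (simp add: conj_class_reps_def)
  \<comment> \<open>Each \<open>u j\<close> is conjugate to itself, so uniqueness of the index
    excludes any other representative.\<close>
  have not_conj: "\<not> conjugate G (u i) (u j)" if "i \<in> {1..n}" "j \<in> {1..n}" "i \<noteq> j" for i j
  proof -
    have "conjugate G (u j) (u j)"
      using uG[OF that(2)] by (auto simp: conjugate_def intro!: bexI[of _ "\<one>\<^bsub>G\<^esub>"])
    then show ?thesis using assms(4) uG that unfolding conj_class_reps_def by blast
  qed
  have "F_map A G n D \<in> module_iso A
      (direct_sum_module {1..n} (\<lambda>i. Hom_Ab G A (centralizer G (u i)))) (Out A G)"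
    if D: "\<And>i \<phi>. i \<in> {1..n} \<Longrightarrow> \<phi> \<in> carrier (Hom_Ab G A (centralizer G (u i))) \<Longrightarrow>
      D_spec A G (u i) \<phi> (D i \<phi>)" for D
    unfolding F_map_def Out_def
  \<comment> \<open>The ambient module is \<open>Der\<close>, the common kernel is
    \<open>Inn\<close>, and the possibly nonlinear sections of the restrictions are the maps
    \<open>D i\<close>.\<close>
  proof (rule module_iso_direct_sum_quotient[where R = "\<lambda>i. centralizer_restriction (u i)"])
    show "D i \<phi> \<in> carrier (Der A G)"
      if "i \<in> {1..n}" "\<phi> \<in> carrier (Hom_Ab G A (centralizer G (u i)))" for i \<phi>
      using D[OF that] by (simp add: D_spec_def)
    show "centralizer_restriction (u j) (D i \<phi>) =
        (if j = i then \<phi> else \<zero>\<^bsub>Hom_Ab G A (centralizer G (u j))\<^esub>)"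
      if "i \<in> {1..n}" "j \<in> {1..n}" "\<phi> \<in> carrier (Hom_Ab G A (centralizer G (u i)))" for i j \<phi>
      using centralizer_restriction_same[OF uG that(3) D] centralizer_restriction_other[OF uG that(3) D uG]
        not_conj that by (simp del: Hom_Ab_simps)
    show "Inn A G = {d \<in> carrier (Der A G). \<forall>i\<in>{1..n}.
        centralizer_restriction (u i) d = \<zero>\<^bsub>Hom_Ab G A (centralizer G (u i))\<^esub>}"
      by (rule Inn_eq_kernel[OF assms(4)])
  qed (rule Der_module Hom_Ab_module centralizer_restriction_hom subgroup_centralizer uG
      finite_atLeastAtMost | assumption)+
  moreover have "\<exists>d. D_spec A G (u i) \<phi> d"
    if "i \<in> {1..n}" "\<phi> \<in> carrier (Hom_Ab G A (centralizer G (u i)))" for i \<phi>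
    using D_spec_exists[OF uG] that by blast
  ultimately show ?thesis by blast
qed

end
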